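(* Let $G$ be a graph with $n$ vertices. Then the stable set polytope $\mathrm{STAB}(G)\subset\mathbb{R}^n$ has psd rank $n+1$ if and only if $G$ is perfect.
   Context: Graphs are finite, simple and undirected, $G=([n],E)$ with $[n]=\{1,\dots,n\}$, $n\ge1$. A stable set of $G$ is a subset $S\subseteq[n]$ such that $\{i,j\}\notin E$ for all $i,j\in S$. Its characteristic vector $\mathcal{X}^S\in\{0,1\}^n$ has $(\mathcal{X}^S)_i=1$ if $i\in S$ and $0$ otherwise. The stable set polytope is $\mathrm{STAB}(G)=\operatorname{conv}\{\mathcal{X}^S: S\text{ a stable set of }G\}\subset\mathbb{R}^n$, an $n$-dimensional polytope. A graph is perfect if for each of its induced subgraphs the chromatic number equals the clique number. $\mathcal{S}_+^k$ denotes the cone of $k\times k$ real symmetric positive semidefinite (psd) matrices. An $\mathcal{S}_+^k$-lift of a polytope $P\subset\mathbb{R}^n$ is a set $\mathcal{S}_+^k\cap L$, with $L$ an affine subspace of the space of real symmetric $k\times k$ matrices, such that $P=\pi(\mathcal{S}_+^k\cap L)$ for some linear map $\pi$ to $\mathbb{R}^n$. The psd rank of $P$ is the smallest positive integer $k$ such that $P$ has an $\mathcal{S}_+^k$-lift. *)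

theory Defs
  imports "HOL-Analysis.Analysis" "Jordan_Normal_Form.Matrix"
begin

section \<open>Finite simple graphs\<close>

text \<open>A graph is given by its vertex set \<open>V\<close> and its set \<open>E\<close> of edges, which are
  two-element subsets of \<open>V\<close>.\<close>

definition simple_graph :: "'a set \<Rightarrow> 'a set set \<Rightarrow> bool" where
  "simple_graph V E \<longleftrightarrow> finite V \<and> (\<forall>e\<in>E. e \<subseteq> V \<and> card e = 2)"

definition stable_set :: "'a set \<Rightarrow> 'a set set \<Rightarrow> 'a set \<Rightarrow> bool" where
  "stable_set V E S \<longleftrightarrow> S \<subseteq> V \<and> (\<forall>i\<in>S. \<forall>j\<in>S. {i, j} \<notin> E)"

definition clique :: "'a set \<Rightarrow> 'a set set \<Rightarrow> 'a set \<Rightarrow> bool" where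
  "clique V E C \<longleftrightarrow> C \<subseteq> V \<and> (\<forall>i\<in>C. \<forall>j\<in>C. i \<noteq> j \<longrightarrow> {i, j} \<in> E)"

definition clique_number :: "'a set \<Rightarrow> 'a set set \<Rightarrow> nat" where
  "clique_number V E = Max (card ` {C. clique V E C})"

definition proper_colouring :: "'a set \<Rightarrow> 'a set set \<Rightarrow> nat \<Rightarrow> ('a \<Rightarrow> nat) \<Rightarrow> bool" where
  "proper_colouring V E k c \<longleftrightarrow>
     c ` V \<subseteq> {..<k} \<and> (\<forall>i\<in>V. \<forall>j\<in>V. {i, j} \<in> E \<longrightarrow> c i \<noteq> c j)"

definition chromatic_number :: "'a set \<Rightarrow> 'a set set \<Rightarrow> nat" where
  "chromatic_number V E = (LEAST k. \<exists>c. proper_colouring V E k c)"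

definition induced_edges :: "'a set set \<Rightarrow> 'a set \<Rightarrow> 'a set set" where
  "induced_edges E W = {e \<in> E. e \<subseteq> W}"

definition perfect_graph :: "'a set \<Rightarrow> 'a set set \<Rightarrow> bool" where
  "perfect_graph V E \<longleftrightarrow>
     (\<forall>W\<subseteq>V. chromatic_number W (induced_edges E W) = clique_number W (induced_edges E W))"


section \<open>The stable set polytope\<close>

definition char_vec :: "'n set \<Rightarrow> real ^ 'n" where
  "char_vec S = (\<chi> i. if i \<in> S then 1 else 0)"

text \<open>The vertices are the elements of the finite index type \<open>'n\<close>, so that the polytope lives in
  \<open>\<real>\<^sup>n\<close> with \<open>n = CARD('n)\<close>.\<close>

definition STAB :: "'n::finite set set \<Rightarrow> (real ^ 'n) set" where
  "STAB E = convex hull {char_vec S | S. stable_set UNIV E S}"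


section \<open>Positive semidefinite lifts and psd rank\<close>

text \<open>The size \<open>k\<close> of the matrices is quantified over in the definition of the psd rank; hence
  they are elements of \<open>carrier_mat k k\<close> rather than of a type depending on \<open>k\<close>. As \<open>real mat\<close> is
  not a real vector space, affine subspaces and linear maps are spelled out on the carrier.\<close>

definition sym_mats :: "nat \<Rightarrow> real mat set" where
  "sym_mats k = {A \<in> carrier_mat k k. transpose_mat A = A}"

definition psd_cone :: "nat \<Rightarrow> real mat set" where
  "psd_cone k = {A \<in> sym_mats k. \<forall>v\<in>carrier_vec k. 0 \<le> scalar_prod v (A *\<^sub>v v)}"

text \<open>As with \<^const>\<open>affine\<close>, the empty set is not excluded; this is
  immaterial for lifts of nonempty sets.\<close>

definition affine_subspace_sym :: "nat \<Rightarrow> real mat set \<Rightarrow> bool" where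
  "affine_subspace_sym k L \<longleftrightarrow> L \<subseteq> sym_mats k \<and>
     (\<forall>X\<in>L. \<forall>Y\<in>L. \<forall>u v. u + v = 1 \<longrightarrow> u \<cdot>\<^sub>m X + v \<cdot>\<^sub>m Y \<in> L)"

definition linear_on_sym :: "nat \<Rightarrow> (real mat \<Rightarrow> 'v::real_vector) \<Rightarrow> bool" where
  "linear_on_sym k f \<longleftrightarrow>
     (\<forall>X\<in>sym_mats k. \<forall>Y\<in>sym_mats k. f (X + Y) = f X + f Y) \<and>
     (\<forall>c. \<forall>X\<in>sym_mats k. f (c \<cdot>\<^sub>m X) = c *\<^sub>R f X)"

definition has_psd_lift :: "nat \<Rightarrow> 'v::real_vector set \<Rightarrow> bool" where
  "has_psd_lift k P \<longleftrightarrow>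
     (\<exists>L f. affine_subspace_sym k L \<and> linear_on_sym k f \<and> P = f ` (psd_cone k \<inter> L))"

text \<open>For a polytope the minimum is over a nonempty set: with as many rows as there are vertices,
  the diagonal matrices of trace one yield a lift.\<close>

definition psd_rank :: "'v::real_vector set \<Rightarrow> nat" where
  "psd_rank P = (LEAST k. 0 < k \<and> has_psd_lift k P)"

end

theory Submission
  imports Defs
begin

text \<open>
  Perfectness of \<open>G\<close> is equivalent to \<open>QSTAB \<subseteq> STAB\<close>, where \<open>QSTAB\<close> is cut out by the nonnegativity
  and clique inequalities. If it holds, the theta body is a lift of size \<open>n + 1\<close>.

  For the converse, consider a lift \<open>P = \<pi>(Q)\<close>. Passing to a smaller face of \<open>P\<close> strictly enlarges the
  common null space of the corresponding face of \<open>Q\<close>. Counting dimensions along flags gives the lower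
  bound \<open>n + 1\<close>; if the size is \<open>n + 1\<close>, then matrices over vertices have rank one, \<open>Y = w w\<^sup>T\<close>, and every
  facet functional has the form \<open>c (u \<bullet> Y u)\<close> on \<open>Q\<close>, so that its values at the vertices are the squares
  of the values of a linear functional at the vectors \<open>w\<close>. For nonadjacent \<open>i, j\<close> the vectors belonging to
  \<open>\<emptyset>, {i}, {j}, {i, j}\<close> satisfy a linear relation with coefficients of equal absolute value, and this
  forces a facet inequality to vanish at \<open>i\<close> or \<open>j\<close>. Hence the support of a facet inequality is a
  clique, which yields \<open>QSTAB \<subseteq> STAB\<close>.\<close>

text \<open>A flag ends at a vertex, where all that is known is that the matrix above it is nonzero,
  because a lift through the zero matrix would have an unbounded image. Its null space thus has
  dimension at most the size minus one, and every step of the flag has used up at least one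
  dimension; this is the origin of n + 1. At size n + 1 there is no slack, so each step of a full
  flag uses exactly one. Over a facet the common null space is then a line spanned by some u, and
  only the form at u decides whether a small move out of the face stays psd. The linear relation
  comes from the same count: where all coordinates other than i and j vanish, the common null space
  has dimension at least n - 2, so the four vectors w lie in a space of dimension at most three. The
  relation does not depend on the facet, and this is what makes it possible to determine its
  coefficients from some facets and to use them for all others. As the psd rank is a minimum over
  all sizes, smaller matrices are padded with zeros to one fixed type; the padding lies in every
  null space and enters the count.\<close>

no_notation scalar_prod (infix "\<bullet>" 70)
no_notation vec_index (infixl "$" 100)

section \<open>Positive semidefinite matrices\<close>

definition psd :: "real^'m^'m \<Rightarrow> bool" where
  "psd Y \<longleftrightarrow> transpose Y = Y \<and> (\<forall>v. 0 \<le> v \<bullet> (Y *v v))"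

definition null_space :: "real^'m^'m \<Rightarrow> (real^'m) set" where
  "null_space Y = {v. Y *v v = 0}"

lemma transpose_add: "transpose (A + B) = transpose A + transpose (B::real^'m^'m)"
  by (simp add: transpose_def Finite_Cartesian_Product.vec_eq_iff)

lemma transpose_diff: "transpose (A - B) = transpose A - transpose (B::real^'m^'m)"
  by (simp add: transpose_def Finite_Cartesian_Product.vec_eq_iff)

lemma transpose_scale: "transpose (c *\<^sub>R A) = c *\<^sub>R transpose (A::real^'m^'m)"
  by (simp add: transpose_def Finite_Cartesian_Product.vec_eq_iff)

lemmas matrix_vec_simps = matrix_vector_mult_add_rdistrib scaleR_matrix_vector_assoc[symmetric]

lemma matrix_minus_vec: "(- A) *v x = - (A *v x)" for A :: "real^'m^'m"
  using scaleR_matrix_vector_assoc[of "-1" A x] by simp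

lemma symmetric_inner:
  assumes "transpose Y = (Y::real^'m^'m)"
  shows "x \<bullet> (Y *v y) = (Y *v x) \<bullet> y"
  by (metis assms dot_lmul_matrix transpose_matrix_vector)

lemma subspace_null: "subspace (null_space Y)"
  unfolding null_space_def subspace_def
  by (auto simp: matrix_vector_right_distrib matrix_vector_mult_scaleR)

lemma psd_add: "psd A \<Longrightarrow> psd B \<Longrightarrow> psd (A + B)"
  by (auto simp: psd_def matrix_vec_simps transpose_add inner_add_right)

lemma psd_scale: "psd A \<Longrightarrow> 0 \<le> c \<Longrightarrow> psd (c *\<^sub>R A)"
  by (auto simp: psd_def matrix_vec_simps transpose_scale)

text \<open>Moving from \<open>v\<close> to \<open>v - t *\<^sub>R (Y *v v)\<close> changes the form
  by -2t|Yv|^2 plus a term of order t^2, so for small t the form would become negative unless Yv =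
  0.\<close>

lemma psd_null:
  assumes "psd Y" "v \<bullet> (Y *v v) = 0"
  shows "v \<in> null_space Y"
proof -
  define w where "w = Y *v v"
  define c where "c = w \<bullet> (Y *v w)"
  have sym: "transpose Y = Y" using assms by (simp add: psd_def)
  have *: "2 * (w \<bullet> w) \<le> t * c" if "t > 0" for t
  proof -
    have "0 \<le> (v - t *\<^sub>R w) \<bullet> (Y *v (v - t *\<^sub>R w))"
      using assms by (simp add: psd_def)
    also have "\<dots> = v \<bullet> (Y *v v) - t * (v \<bullet> (Y *v w)) - t * (w \<bullet> w) + t * (t * c)"
      by (simp add: matrix_vector_mult_diff_distrib matrix_vector_mult_scaleR inner_diff_left
          inner_diff_right w_def[symmetric] c_def algebra_simps)
    also have "v \<bullet> (Y *v w) = w \<bullet> w"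
      by (simp add: symmetric_inner[OF sym] w_def)
    finally have "t * (2 * (w \<bullet> w)) \<le> t * (t * c)" using assms by simp
    then show ?thesis using that by simp
  qed
  have "((\<lambda>t. t * c) \<longlongrightarrow> 0 * c) (at_right 0)"
    by (intro tendsto_intros)
  moreover have "\<forall>\<^sub>F t in at_right 0. 2 * (w \<bullet> w) \<le> t * c"
    using * by (auto simp: eventually_at_right_less intro: eventually_mono[OF eventually_at_right_less])
  ultimately have "2 * (w \<bullet> w) \<le> 0 * c"
    by (intro tendsto_lowerbound) auto
  then have "w = 0" using inner_gt_zero_iff[of w] by (auto simp: not_less[symmetric])
  then show ?thesis by (simp add: null_space_def w_def)
qed

lemma null_add:
  assumes "psd A" "psd B"
  shows "null_space (A + B) = null_space A \<inter> null_space B"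
proof -
  have "v \<in> null_space A \<inter> null_space B" if "v \<in> null_space (A + B)" for v
  proof -
    have "v \<bullet> (A *v v) + v \<bullet> (B *v v) = 0"
      using that by (simp add: null_space_def matrix_vec_simps inner_add_right[symmetric])
    moreover have "0 \<le> v \<bullet> (A *v v)" "0 \<le> v \<bullet> (B *v v)" using assms by (auto simp: psd_def)
    ultimately have "v \<bullet> (A *v v) = 0" "v \<bullet> (B *v v) = 0" by auto
    then show ?thesis using assms by (auto intro: psd_null)
  qed
  then show ?thesis by (auto simp: null_space_def matrix_vec_simps)
qed

lemma null_scale: "c \<noteq> 0 \<Longrightarrow> null_space (c *\<^sub>R A) = null_space A"
  by (simp add: null_space_def matrix_vec_simps)

text \<open>On the compact unit sphere of the orthogonal complement of the null space the form is
  positive by \<open>psd_null\<close>, hence bounded away from 0; homogeneity does the rest.\<close>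

lemma psd_coercive:
  fixes Z :: "real^'m^'m"
  assumes "psd Z"
  obtains \<mu> where "\<mu> > 0" "\<And>y. (\<And>s. s \<in> null_space Z \<Longrightarrow> s \<bullet> y = 0) \<Longrightarrow> \<mu> * (y \<bullet> y) \<le> y \<bullet> (Z *v y)"
proof -
  define N where "N = {y. \<forall>s\<in>null_space Z. s \<bullet> y = 0}"
  have N: "y \<in> N \<longleftrightarrow> (\<forall>s\<in>null_space Z. s \<bullet> y = 0)" for y by (simp add: N_def)
  have "N = (\<Inter>s\<in>null_space Z. {y. s \<bullet> y = 0})" by (auto simp: N_def)
  then have "closed N" by (auto intro!: closed_INT closed_hyperplane)
  then have comp: "compact (sphere 0 1 \<inter> N)" by (intro compact_Int_closed) auto
  have cont: "continuous_on (sphere 0 1 \<inter> N) (\<lambda>y. y \<bullet> (Z *v y))"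
    by (intro continuous_intros linear_continuous_on) (auto simp: linear_linear)
  have pos: "0 < y \<bullet> (Z *v y)" if "y \<in> sphere 0 1 \<inter> N" for y
  proof (rule ccontr)
    assume "\<not> ?thesis"
    then have "y \<bullet> (Z *v y) = 0" using assms by (simp add: psd_def order_antisym)
    then have "y \<in> null_space Z" using assms by (rule psd_null[rotated])
    then have "y \<bullet> y = 0" using that by (auto simp: N)
    then show False using that by auto
  qed
  obtain \<mu> where \<mu>: "\<mu> > 0" "\<And>y. y \<in> sphere 0 1 \<inter> N \<Longrightarrow> \<mu> \<le> y \<bullet> (Z *v y)"
  proof (cases "sphere 0 1 \<inter> N = {}")
    \<comment> \<open>The null space is the whole space here, so any positive constant
      works.\<close>
    case True then show ?thesis using that[of 1] by auto
  next
    case False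
    from continuous_attains_inf[OF comp this cont] pos that show ?thesis by blast
  qed
  show thesis
  proof (rule that[OF \<mu>(1)])
    fix y assume y: "\<And>s. s \<in> null_space Z \<Longrightarrow> s \<bullet> y = 0"
    show "\<mu> * (y \<bullet> y) \<le> y \<bullet> (Z *v y)"
    proof (cases "y = 0")
      case False
      define e where "e = (1 / norm y) *\<^sub>R y"
      have "e \<in> sphere 0 1 \<inter> N" using False y by (simp add: e_def N)
      then have "\<mu> \<le> e \<bullet> (Z *v e)" by (rule \<mu>)
      also have "\<dots> = (y \<bullet> (Z *v y)) / (y \<bullet> y)"
        by (simp add: e_def matrix_vector_mult_scaleR power2_norm_eq_inner[symmetric] power2_eq_square divide_simps)
      finally show ?thesis using False by (simp add: pos_le_divide_eq)
    qed simp
  qed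
qed

text \<open>The condition on \<open>D\<close> covers both a \<open>D\<close> that vanishes on the null space of \<open>Z\<close> and one that is
  positive definite there.\<close>

lemma psd_perturb:
  fixes Z D :: "real^'m^'m"
  assumes "psd Z" "transpose D = D" "\<delta> > 0"
    and D: "\<And>s. s \<in> null_space Z \<Longrightarrow> \<delta> * ((D *v s) \<bullet> (D *v s)) \<le> s \<bullet> (D *v s)"
  obtains \<epsilon> where "\<epsilon> > 0" "psd (Z + \<epsilon> *\<^sub>R D)"
proof -
  obtain \<mu> where \<mu>: "\<mu> > 0" "\<And>y. (\<And>s. s \<in> null_space Z \<Longrightarrow> s \<bullet> y = 0) \<Longrightarrow> \<mu> * (y \<bullet> y) \<le> y \<bullet> (Z *v y)"
    using psd_coercive[OF assms(1)] by blast
  obtain d where d: "d > 0" "\<And>y. norm (D *v y) \<le> d * norm y"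
    using linear_bounded_pos[of "(*v) D"] by (auto simp: mult.commute)
  \<comment> \<open>The first bound leaves half of the coercivity on \<open>y\<close> after paying
    for the term in \<open>D\<close> on \<open>y\<close>; the second lets the gain
    \<open>\<delta> * r\<^sup>2\<close> on \<open>s\<close> absorb what remains of the cross
    term.\<close>
  define \<epsilon> where "\<epsilon> = min (\<mu> / (2 * d)) (\<mu> * \<delta> / 2)"
  have \<epsilon>: "\<epsilon> > 0" "\<epsilon> * d \<le> \<mu> / 2" "\<epsilon> \<le> \<mu> * \<delta> / 2"
    using \<mu> d assms by (auto simp: \<epsilon>_def min_def field_simps)
  have sZ: "transpose Z = Z" using assms by (simp add: psd_def)
  have "0 \<le> v \<bullet> ((Z + \<epsilon> *\<^sub>R D) *v v)" for v
  proof -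
    obtain s y where "s \<in> span (null_space Z)" "\<And>w. w \<in> span (null_space Z) \<Longrightarrow> Linear_Algebra.orthogonal y w"
      and v: "v = s + y"
      using orthogonal_subspace_decomp_exists[of "null_space Z" v] by blast
    then have sy: "s \<in> null_space Z" "\<And>w. w \<in> null_space Z \<Longrightarrow> y \<bullet> w = 0" "v = s + y"
      using span_minimal[OF order_refl subspace_null[of Z]] v
      by (auto simp: Linear_Algebra.orthogonal_def span_base)
    define r where "r = norm (D *v s)"
    have y: "\<mu> * (norm y)\<^sup>2 \<le> y \<bullet> (Z *v y)"
      using \<mu>(2)[of y] sy(2) by (simp add: power2_norm_eq_inner inner_commute)
    have Zv: "v \<bullet> (Z *v v) = y \<bullet> (Z *v y)"
      using sy(1) by (simp add: sy(3) matrix_vector_right_distrib null_space_def symmetric_inner[OF sZ])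
    have "\<bar>y \<bullet> (D *v y)\<bar> \<le> norm y * norm (D *v y)" by (rule Cauchy_Schwarz_ineq2)
    also have "\<dots> \<le> norm y * (d * norm y)" using d by (intro mult_left_mono) auto
    finally have yD: "- (d * (norm y)\<^sup>2) \<le> y \<bullet> (D *v y)"
      by (simp add: power2_eq_square mult_ac)
    have "\<bar>y \<bullet> (D *v s)\<bar> \<le> norm y * r" unfolding r_def by (rule Cauchy_Schwarz_ineq2)
    then have yDs: "- (norm y * r) \<le> y \<bullet> (D *v s)" by linarith
    have sD: "\<delta> * r\<^sup>2 \<le> s \<bullet> (D *v s)"
      using D[OF sy(1)] by (simp add: r_def power2_norm_eq_inner)
    have "v \<bullet> (D *v v) = s \<bullet> (D *v s) + 2 * (y \<bullet> (D *v s)) + y \<bullet> (D *v y)"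
      by (simp add: sy(3) matrix_vector_right_distrib inner_add_left inner_add_right
          symmetric_inner[OF assms(2), of s y] inner_commute[of "D *v s" y])
    then have Dv: "\<delta> * r\<^sup>2 - 2 * (norm y * r) - d * (norm y)\<^sup>2 \<le> v \<bullet> (D *v v)"
      using sD yD yDs by linarith
    \<comment> \<open>This square is completed around the cross term 2 \<epsilon> |y| r.\<close>
    have "0 \<le> (\<mu> / 2) * (norm y - 2 * \<epsilon> / \<mu> * r)\<^sup>2"
      using \<mu> by simp
    also have "\<dots> = (\<mu> / 2) * (norm y)\<^sup>2 - 2 * \<epsilon> * (norm y * r) + \<epsilon> * (2 * \<epsilon> / \<mu>) * r\<^sup>2"
      using \<mu> by (simp add: power2_eq_square field_simps)
    also have "\<dots> \<le> (\<mu> - \<epsilon> * d) * (norm y)\<^sup>2 - 2 * \<epsilon> * (norm y * r) + \<epsilon> * \<delta> * r\<^sup>2"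
    proof -
      have "(\<mu> / 2) * (norm y)\<^sup>2 \<le> (\<mu> - \<epsilon> * d) * (norm y)\<^sup>2"
        using \<epsilon> by (intro mult_right_mono) auto
      moreover have "\<epsilon> * (2 * \<epsilon> / \<mu>) * r\<^sup>2 \<le> \<epsilon> * \<delta> * r\<^sup>2"
        using \<epsilon> \<mu> by (intro mult_right_mono mult_left_mono) (auto simp: field_simps)
      ultimately show ?thesis by linarith
    qed
    also have "\<dots> = \<mu> * (norm y)\<^sup>2 + \<epsilon> * (\<delta> * r\<^sup>2 - 2 * (norm y * r) - d * (norm y)\<^sup>2)"
      by (simp add: algebra_simps)
    also have "\<dots> \<le> v \<bullet> (Z *v v) + \<epsilon> * (v \<bullet> (D *v v))"
      using y Zv Dv \<epsilon> by (intro add_mono mult_left_mono) auto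
    finally show ?thesis by (simp add: matrix_vec_simps inner_add_right)
  qed
  then have "psd (Z + \<epsilon> *\<^sub>R D)"
    using sZ assms(2) by (simp add: psd_def transpose_add transpose_scale)
  then show thesis using \<epsilon>(1) that by blast
qed

text \<open>If the null space is not everything, it is the hyperplane orthogonal to some unit vector
  \<open>e\<close>. The form then sees only the component along \<open>e\<close>, so
  \<open>w\<close> is \<open>e\<close> scaled by the square root of its value there.\<close>

lemma psd_rank_le_one:
  fixes B :: "real^'m^'m"
  assumes "psd B" "CARD('m) \<le> dim (null_space B) + 1"
  obtains w where "\<And>v. v \<bullet> (B *v v) = (w \<bullet> v)\<^sup>2" "\<And>s. s \<in> null_space B \<Longrightarrow> w \<bullet> s = 0"
proof -
  define N where "N = null_space B"
  have sN: "subspace N" by (simp add: N_def subspace_null)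
  show thesis
  proof (cases "N = UNIV")
    case True
    then have "B *v v = 0" for v by (auto simp: N_def null_space_def)
    then show ?thesis using that[of 0] by simp
  next
    case False
    then have "span N \<subset> span UNIV" using span_minimal[OF order_refl sN] by auto
    then obtain a where "a \<noteq> 0" "\<And>y. y \<in> span N \<Longrightarrow> Linear_Algebra.orthogonal a y"
      using orthogonal_to_subspace_exists_gen[of N UNIV] by blast
    then have a: "a \<noteq> 0" "\<And>y. y \<in> N \<Longrightarrow> a \<bullet> y = 0"
      by (auto simp: Linear_Algebra.orthogonal_def span_base)
    have Na: "N = {x. a \<bullet> x = 0}"
    proof (rule subspace_dim_equal)
      show "subspace {x. a \<bullet> x = 0}" by (rule subspace_hyperplane)
      show "N \<subseteq> {x. a \<bullet> x = 0}" using a by auto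
      show "dim {x. a \<bullet> x = 0} \<le> dim N"
        using dim_hyperplane[OF a(1)] assms(2) by (simp add: N_def)
    qed (rule sN)
    define e where "e = (1 / norm a) *\<^sub>R a"
    have e: "e \<bullet> e = 1" using a by (simp add: e_def power2_norm_eq_inner[symmetric] power2_eq_square)
    have Ne: "x \<in> N \<longleftrightarrow> e \<bullet> x = 0" for x using Na a by (simp add: e_def)
    have sB: "transpose B = B" using assms by (simp add: psd_def)
    define k where "k = e \<bullet> (B *v e)"
    have k: "k \<ge> 0" using assms by (simp add: psd_def k_def)
    have "v \<bullet> (B *v v) = ((sqrt k *\<^sub>R e) \<bullet> v)\<^sup>2" for v
    proof -
      define s where "s = v - (e \<bullet> v) *\<^sub>R e"
      have "s \<in> N" by (simp add: Ne s_def inner_diff_right e)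
      then have "B *v s = 0" by (simp add: N_def null_space_def)
      moreover have "v = s + (e \<bullet> v) *\<^sub>R e" by (simp add: s_def)
      ultimately have "v \<bullet> (B *v v) = ((e \<bullet> v) *\<^sub>R e) \<bullet> (B *v ((e \<bullet> v) *\<^sub>R e))"
        by (smt (verit) add.left_neutral inner_add_left inner_zero_left matrix_vector_right_distrib symmetric_inner[OF sB])
      also have "\<dots> = k * (e \<bullet> v)\<^sup>2"
        by (simp add: matrix_vector_mult_scaleR k_def power2_eq_square)
      finally show ?thesis using k by (simp add: power_mult_distrib)
    qed
    then show ?thesis using that[of "sqrt k *\<^sub>R e"] Ne by (simp add: N_def)
  qed
qed

section \<open>Faces of polytopes and of their psd lifts\<close>

text \<open>A functional with a zero set of maximal dimension that is not yet a facet could be tilted along a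
  direction vanishing on its zeros and at \<open>z\<close> until a further zero appears.\<close>

lemma facet_exists:
  fixes T :: "'a::euclidean_space set"
  assumes fin: "finite T" and z: "z \<in> span T" and l: "\<forall>x\<in>T. 0 \<le> l \<bullet> x" "l \<bullet> z < 0"
  obtains l' where "\<forall>x\<in>T. 0 \<le> l' \<bullet> x" "l' \<bullet> z < 0" "\<forall>x\<in>T. l \<bullet> x = 0 \<longrightarrow> l' \<bullet> x = 0"
    "dim T \<le> dim {x \<in> T. l' \<bullet> x = 0} + 1"
proof -
  define P where "P k \<longleftrightarrow> (\<forall>x\<in>T. 0 \<le> k \<bullet> x) \<and> k \<bullet> z < 0 \<and> (\<forall>x\<in>T. l \<bullet> x = 0 \<longrightarrow> k \<bullet> x = 0)" for k
  have "P l" using l by (simp add: P_def)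
  moreover have "\<forall>k. P k \<longrightarrow> dim {x \<in> T. k \<bullet> x = 0} < DIM('a) + 1"
    by (simp add: dim_subset_UNIV less_Suc_eq_le)
  ultimately have "\<exists>k. P k \<and> (\<forall>k'. P k' \<longrightarrow> dim {x \<in> T. k' \<bullet> x = 0} \<le> dim {x \<in> T. k \<bullet> x = 0})"
    by (rule ex_has_greatest_nat)
  then obtain k where k: "P k" "\<And>k'. P k' \<Longrightarrow> dim {x \<in> T. k' \<bullet> x = 0} \<le> dim {x \<in> T. k \<bullet> x = 0}"
    by blast
  define Z where "Z = {x \<in> T. k \<bullet> x = 0}"
  have "dim T \<le> dim Z + 1"
  proof (rule ccontr)
    assume "\<not> ?thesis"
    \<comment> \<open>A zero set of codimension at least two leaves room to fix the value at
      \<open>z\<close> as well, which keeps it negative.\<close>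
    then have "dim (insert z Z) < dim T" by (simp add: dim_insert)
    moreover have "insert z Z \<subseteq> span T" using z by (auto simp: Z_def span_base)
    then have "span (insert z Z) \<subseteq> span T" by (rule span_minimal) (rule subspace_span)
    ultimately have "span (insert z Z) \<subset> span T" by (metis dim_span less_irrefl psubsetI)
    then obtain d where d: "d \<noteq> 0" "d \<in> span T"
      "\<And>y. y \<in> span (insert z Z) \<Longrightarrow> Linear_Algebra.orthogonal d y"
      using orthogonal_to_subspace_exists_gen by blast
    \<comment> \<open>A nonzero \<open>d\<close> in \<open>span T\<close> cannot vanish on all of
      \<open>T\<close>; the sign of \<open>e\<close> is chosen so that some point is pushed
      down.\<close>
    have "\<exists>x\<in>T. d \<bullet> x \<noteq> 0"
    proof (rule ccontr)
      assume "\<not> ?thesis"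
      then have "T \<subseteq> {x. d \<bullet> x = 0}" by auto
      then have "span T \<subseteq> {x. d \<bullet> x = 0}" by (rule span_minimal) (rule subspace_hyperplane)
      then show False using d by auto
    qed
    then obtain x e where x: "x \<in> T" "e \<bullet> x < 0" and e: "e = d \<or> e = - d"
      by (metis inner_minus_left linorder_neqE_linordered_idom neg_less_0_iff_less)
    have ez: "e \<bullet> z = 0" and eZ: "\<And>y. y \<in> Z \<Longrightarrow> e \<bullet> y = 0"
      using d(3) e by (auto simp: Linear_Algebra.orthogonal_def span_base)
    define N where "N = {x \<in> T. e \<bullet> x < 0}"
    \<comment> \<open>Ratio test: the largest step along \<open>e\<close> that keeps all of
      \<open>T\<close> nonnegative. A minimiser becomes the new zero, and it lies outside
      \<open>span Z\<close> because \<open>e\<close> vanishes there.\<close>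
    define \<epsilon> where "\<epsilon> = Min ((\<lambda>x. k \<bullet> x / (- (e \<bullet> x))) ` N)"
    have N: "finite N" "N \<noteq> {}" using fin x by (auto simp: N_def)
    then have "\<epsilon> \<in> (\<lambda>x. k \<bullet> x / (- (e \<bullet> x))) ` N" unfolding \<epsilon>_def by (intro Min_in) auto
    then obtain x0 where x0: "x0 \<in> N" "\<epsilon> = k \<bullet> x0 / (- (e \<bullet> x0))" by blast
    have pos: "0 \<le> k \<bullet> x" if "x \<in> T" for x using k(1) that by (simp add: P_def)
    have \<epsilon>0: "\<epsilon> \<ge> 0" unfolding x0(2) using x0(1) pos[of x0] by (intro divide_nonneg_pos) (auto simp: N_def)
    define k' where "k' = k + \<epsilon> *\<^sub>R e"
    have k': "k' \<bullet> y = k \<bullet> y + \<epsilon> * (e \<bullet> y)" for y by (simp add: k'_def inner_add_left)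
    have "0 \<le> k' \<bullet> y" if "y \<in> T" for y
    proof (cases "e \<bullet> y < 0")
      case True
      then have "\<epsilon> \<le> k \<bullet> y / (- (e \<bullet> y))"
        unfolding \<epsilon>_def using N that by (intro Min_le) (auto simp: N_def)
      then have "\<epsilon> * (- (e \<bullet> y)) \<le> k \<bullet> y" using True by (subst (asm) pos_le_divide_eq) auto
      then show ?thesis by (simp add: k')
    next
      case False
      then show ?thesis using pos[OF that] \<epsilon>0 by (simp add: k')
    qed
    moreover have keep: "k' \<bullet> y = 0" if "y \<in> Z" for y using that eZ by (simp add: k' Z_def)
    ultimately have "P k'" using k(1) ez by (auto simp: P_def k' Z_def)
    have "k' \<bullet> x0 = 0" using x0 by (simp add: k' N_def)
    then have sub: "insert x0 Z \<subseteq> {x \<in> T. k' \<bullet> x = 0}"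
      using keep x0 by (auto simp: Z_def N_def)
    have "Z \<subseteq> {y. e \<bullet> y = 0}" using eZ by auto
    then have "span Z \<subseteq> {y. e \<bullet> y = 0}" by (rule span_minimal) (rule subspace_hyperplane)
    then have "x0 \<notin> span Z" using x0 by (auto simp: N_def)
    then have "dim Z < dim (insert x0 Z)" by (simp add: dim_insert)
    also have "\<dots> \<le> dim {x \<in> T. k' \<bullet> x = 0}" by (rule dim_subset[OF sub])
    finally show False using k(2)[OF \<open>P k'\<close>] by (simp add: Z_def)
  qed
  then show thesis using that[of k] k(1) by (auto simp: P_def Z_def)
qed

section \<open>Common null spaces of faces, and the dimension count along flags\<close>

definition common_null :: "(real^'m^'m) set \<Rightarrow> (real^'m) set" where
  "common_null F = (\<Inter>Y\<in>F. null_space Y)"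

lemma subspace_common_null: "subspace (common_null F)"
  unfolding common_null_def by (rule subspace_Inter) (auto simp: subspace_null)

lemma common_null_antimono: "F \<subseteq> G \<Longrightarrow> common_null G \<subseteq> common_null F"
  by (auto simp: common_null_def)

text \<open>The null space of a midpoint is the intersection of the two null spaces. A member whose
  null space has least dimension therefore has it contained in all the others; it plays the role of
  a relative interior point.\<close>

lemma null_eq_common_null:
  fixes F :: "(real^'m^'m) set"
  assumes "convex F" "F \<noteq> {}" "\<And>Y. Y \<in> F \<Longrightarrow> psd Y"
  obtains Z where "Z \<in> F" "null_space Z = common_null F"
proof -
  obtain Z where Z: "Z \<in> F" "\<And>Y. Y \<in> F \<Longrightarrow> dim (null_space Z) \<le> dim (null_space Y)"
    using ex_has_least_nat[of "\<lambda>Y. Y \<in> F" _ "\<lambda>Y. dim (null_space Y)"] assms(2) by blast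
  have "null_space Z \<subseteq> null_space Y" if "Y \<in> F" for Y
  proof -
    define W where "W = (1/2) *\<^sub>R Z + (1/2) *\<^sub>R Y"
    have "W \<in> F" unfolding W_def using assms(1) Z(1) that by (rule convexD) auto
    have W: "null_space W = null_space Z \<inter> null_space Y"
      unfolding W_def using assms(3)[OF Z(1)] assms(3)[OF that]
      by (subst null_add) (auto simp: null_scale intro: psd_scale)
    have "null_space W = null_space Z"
    proof (rule subspace_dim_equal[OF subspace_null subspace_null])
      show "null_space W \<subseteq> null_space Z" using W by blast
      show "dim (null_space Z) \<le> dim (null_space W)" by (rule Z(2)[OF \<open>W \<in> F\<close>])
    qed
    then show ?thesis using W by auto
  qed
  then have "null_space Z = common_null F" using Z(1) by (auto simp: common_null_def)
  with Z(1) that show thesis by blast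
qed

text \<open>\<open>zero_notin\<close> starts the dimension count: it keeps the null space of every
  lifted point proper.\<close>

locale psd_lifted_polytope =
  fixes L :: "(real^'m^'m) set" and \<pi> :: "real^'m^'m \<Rightarrow> 'v::euclidean_space" and T :: "'v set"
  assumes affine_L: "affine L" and linear_\<pi>: "linear \<pi>" and finite_T: "finite T"
    and lift: "\<pi> ` {Y \<in> L. psd Y} = convex hull T" and zero_notin: "0 \<notin> L"
begin

definition "Q = {Y \<in> L. psd Y}"

text \<open>Homogenisation: at height one, affine functionals on the polytope become linear ones on
  pairs, and linear dimension is affine dimension plus one.\<close>

definition "H = Pair (1::real) ` T"

definition valid :: "real \<times> 'v \<Rightarrow> bool" where
  "valid l \<longleftrightarrow> (\<forall>h\<in>H. 0 \<le> l \<bullet> h)"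

definition eval_at :: "real \<times> 'v \<Rightarrow> real^'m^'m \<Rightarrow> real" where
  "eval_at l Y = l \<bullet> (1, \<pi> Y)"

definition face :: "real \<times> 'v \<Rightarrow> (real^'m^'m) set" where
  "face l = {Y \<in> Q. eval_at l Y = 0}"

definition tight :: "real \<times> 'v \<Rightarrow> (real \<times> 'v) set" where
  "tight l = {h \<in> H. l \<bullet> h = 0}"

lemma finite_H: "finite H"
  using finite_T by (simp add: H_def)

lemma Q_psd: "Y \<in> Q \<Longrightarrow> psd Y" and Q_L: "Y \<in> Q \<Longrightarrow> Y \<in> L"
  by (auto simp: Q_def)

lemma point_lift:
  assumes "(1, x) \<in> H"
  obtains Y where "Y \<in> Q" "\<pi> Y = x"
proof -
  have "x \<in> convex hull T" using assms by (auto simp: H_def hull_inc)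
  then show thesis using that by (auto simp: Q_def lift[symmetric])
qed

lemma eval_at_add: "eval_at (l + k) Y = eval_at l Y + eval_at k Y"
  by (simp add: eval_at_def inner_add_left)

lemma eval_at_affine:
  "eval_at l (Z + a *\<^sub>R (X - Z) + b *\<^sub>R (Y - Z)) =
    eval_at l Z + a * (eval_at l X - eval_at l Z) + b * (eval_at l Y - eval_at l Z)"
proof -
  have "\<pi> (Z + a *\<^sub>R (X - Z) + b *\<^sub>R (Y - Z)) = \<pi> Z + a *\<^sub>R (\<pi> X - \<pi> Z) + b *\<^sub>R (\<pi> Y - \<pi> Z)"
    by (simp add: linear_add[OF linear_\<pi>] linear_diff[OF linear_\<pi>] linear_scale[OF linear_\<pi>])
  then show ?thesis
    by (cases l) (simp add: eval_at_def inner_add_right inner_diff_right)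
qed

lemma L_affine: "X \<in> L \<Longrightarrow> Y \<in> L \<Longrightarrow> Z \<in> L \<Longrightarrow> Z + a *\<^sub>R (X - Z) + b *\<^sub>R (Y - Z) \<in> L"
  using mem_affine_3[OF affine_L, of Z X Y "1 - a - b" a b] by (simp add: algebra_simps)

lemma eval_at_nonneg:
  assumes "valid l" "Y \<in> Q"
  shows "0 \<le> eval_at l Y"
proof -
  have "\<pi> Y \<in> convex hull T" using assms(2) lift by (auto simp: Q_def)
  also have "\<dots> \<subseteq> {x. - fst l \<le> snd l \<bullet> x}"
  proof (rule hull_minimal)
    show "T \<subseteq> {x. - fst l \<le> snd l \<bullet> x}"
      using assms(1) by (cases l) (auto simp: valid_def H_def)
  qed (use convex_halfspace_ge[of "- fst l" "snd l"] in simp)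
  finally show ?thesis by (cases l) (auto simp: eval_at_def)
qed

lemma valid_add: "valid l \<Longrightarrow> valid k \<Longrightarrow> valid (l + k)"
  by (auto simp: valid_def inner_add_left)

text \<open>Flags are built by adding valid functionals: a sum of nonnegative values vanishes only
  where both do, so addition intersects faces.\<close>

lemma face_add: "valid l \<Longrightarrow> valid k \<Longrightarrow> face (l + k) = face l \<inter> face k"
  using eval_at_nonneg[of l] eval_at_nonneg[of k] by (auto simp: face_def eval_at_add add_nonneg_eq_0_iff)

lemma tight_add: "valid l \<Longrightarrow> valid k \<Longrightarrow> tight (l + k) = tight l \<inter> tight k"
  by (auto simp: valid_def tight_def inner_add_left add_nonneg_eq_0_iff)

lemma face_zero: "face 0 = Q" and valid_zero: "valid 0" and tight_zero: "tight 0 = H"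
  by (auto simp: face_def eval_at_def valid_def tight_def)

lemma convex_face: "convex (face l)"
proof (rule convexI)
  fix X Y and u v :: real
  assume XY: "X \<in> face l" "Y \<in> face l" and uv: "0 \<le> u" "0 \<le> v" "u + v = 1"
  have u: "u = 1 - v" using uv(3) by simp
  have eq: "u *\<^sub>R X + v *\<^sub>R Y = X + 0 *\<^sub>R (X - X) + v *\<^sub>R (Y - X)"
    using uv(3) by (simp add: u algebra_simps)
  have "u *\<^sub>R X + v *\<^sub>R Y \<in> L" unfolding eq by (intro L_affine Q_L) (use XY in \<open>auto simp: face_def\<close>)
  moreover have "psd (u *\<^sub>R X + v *\<^sub>R Y)"
    using XY uv by (intro psd_add psd_scale Q_psd) (auto simp: face_def)
  moreover have "eval_at l (u *\<^sub>R X + v *\<^sub>R Y) = 0"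
    unfolding eq eval_at_affine using XY by (simp add: face_def)
  ultimately show "u *\<^sub>R X + v *\<^sub>R Y \<in> face l" by (simp add: face_def Q_def)
qed

lemma face_generic:
  assumes "face l \<noteq> {}"
  obtains Z where "Z \<in> face l" "null_space Z = common_null (face l)"
  using null_eq_common_null[OF convex_face assms] Q_psd by (auto simp: face_def)

text \<open>Otherwise one could leave \<open>Q\<close> through a relative interior point of the smaller face, moving
  away from \<open>Y\<close>.\<close>

lemma dim_common_null_less:
  assumes l: "valid l" and k: "valid k" and ne: "face (l + k) \<noteq> {}"
    and Y: "Y \<in> face l" "eval_at k Y > 0"
  shows "dim (common_null (face l)) < dim (common_null (face (l + k)))"
proof (rule ccontr)
  assume "\<not> ?thesis"
  moreover have "common_null (face l) \<subseteq> common_null (face (l + k))"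
    using face_add[OF l k] by (intro common_null_antimono) auto
  ultimately have eq: "common_null (face l) = common_null (face (l + k))"
    by (intro subspace_dim_equal subspace_common_null) auto
  obtain Z where Z: "Z \<in> face (l + k)" "null_space Z = common_null (face (l + k))"
    using face_generic[OF ne] by blast
  have "null_space Z \<subseteq> null_space Y" using Y(1) unfolding Z(2) eq[symmetric] by (auto simp: common_null_def)
  then have D: "(Z - Y) *v s = 0" if "s \<in> null_space Z" for s
    using that by (auto simp: null_space_def matrix_vector_mult_diff_rdistrib)
  have QZ: "Z \<in> Q" and QY: "Y \<in> Q" using Z(1) Y(1) by (auto simp: face_def)
  have "transpose (Z - Y) = Z - Y"
    using Q_psd[OF QZ] Q_psd[OF QY] by (simp add: psd_def transpose_diff)
  \<comment> \<open>\<open>Z - Y\<close> vanishes on the null space of \<open>Z\<close>, so both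
    sides of the condition in \<open>psd_perturb\<close> are 0 and the constant 1 is a mere
    choice.\<close>
  then obtain \<epsilon> where \<epsilon>: "\<epsilon> > 0" "psd (Z + \<epsilon> *\<^sub>R (Z - Y))"
    using psd_perturb[OF Q_psd[OF QZ], of "Z - Y" 1] D by auto
  have eq: "Z + \<epsilon> *\<^sub>R (Z - Y) = Z + (- \<epsilon>) *\<^sub>R (Y - Z) + 0 *\<^sub>R (Y - Z)"
    by (simp add: algebra_simps)
  have "Z + \<epsilon> *\<^sub>R (Z - Y) \<in> Q"
    using \<epsilon>(2) L_affine[OF Q_L[OF QY] Q_L[OF QY] Q_L[OF QZ], of "- \<epsilon>" 0] unfolding eq by (simp add: Q_def)
  then have "0 \<le> eval_at k (Z + \<epsilon> *\<^sub>R (Z - Y))" by (rule eval_at_nonneg[OF k])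
  also have "\<dots> = - \<epsilon> * eval_at k Y"
    using Z(1) unfolding eq eval_at_affine face_add[OF l k] by (simp add: face_def)
  finally show False using \<epsilon>(1) Y(2) by (simp add: mult_le_0_iff)
qed

lemma matrix_eq_0:
  assumes "\<And>v. (Y::real^'m^'m) *v v = 0" shows "Y = 0"
  using assms matrix_eq[of Y 0] by simp

lemma dim_null_less:
  assumes "Y \<in> Q" shows "dim (null_space Y) < CARD('m)"
proof -
  have "Y \<noteq> 0" using assms zero_notin by (auto simp: Q_def)
  then have "null_space Y \<noteq> UNIV" using matrix_eq_0[of Y] by (auto simp: null_space_def)
  then have "span (null_space Y) \<subset> span UNIV" using span_minimal[OF order_refl subspace_null[of Y]] by auto
  from dim_psubset[OF this] show ?thesis by simp
qed

text \<open>Passing to a facet of the current face lowers \<open>dim (tight l)\<close> by at least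
  one, and the choice of a facet limits the loss to exactly one, while the common null space gains
  at least one dimension. At a vertex the claim is \<open>dim_null_less\<close>.\<close>

lemma dim_common_null_tight:
  assumes "valid l" "tight l \<noteq> {}"
  shows "dim (common_null (face l)) + dim (tight l) \<le> CARD('m)"
  using assms
proof (induction "dim (tight l)" arbitrary: l rule: less_induct)
  case less
  obtain x where x: "(1, x) \<in> tight l" using less.prems(2) by (auto simp: tight_def H_def)
  then obtain Y where Y: "Y \<in> Q" "\<pi> Y = x" using point_lift by (auto simp: tight_def)
  have Yl: "Y \<in> face l" using Y x by (auto simp: face_def tight_def eval_at_def)
  show ?case
  proof (cases "dim (tight l) \<le> 1")
    case True
    have "dim (common_null (face l)) \<le> dim (null_space Y)"
      using Yl by (intro dim_subset) (auto simp: common_null_def)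
    then show ?thesis using dim_null_less[OF Y(1)] True by linarith
  next
    case False
    have finT: "finite (tight l)" using finite_H by (simp add: tight_def)
    obtain k where k: "\<forall>h\<in>tight l. 0 \<le> k \<bullet> h" "k \<bullet> (- (1, x)) < 0"
      "dim (tight l) \<le> dim {h \<in> tight l. k \<bullet> h = 0} + 1"
    \<comment> \<open>The functional \<open>(1, 0)\<close> is 1 on all of \<open>H\<close>. Taking
      the negative of a tight point as the point to be cut off forces the facet functional to be
      positive at \<open>x\<close>, hence not identically zero on the face.\<close>
    proof (rule facet_exists[OF finT])
      show "- (1, x) \<in> span (tight l)" using x by (intro span_neg span_base)
      show "\<forall>h\<in>tight l. 0 \<le> (1::real, 0) \<bullet> h" by (auto simp: tight_def H_def)
      show "(1::real, 0) \<bullet> (- (1, x)) < 0" by simp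
    qed auto
    have kx: "k \<bullet> (1, x) > 0" using k(2) unfolding inner_minus_right by simp
    define Z where "Z = {h \<in> tight l. k \<bullet> h = 0}"
    have "span Z \<subseteq> {h. k \<bullet> h = 0}"
      by (rule span_minimal) (auto simp: Z_def subspace_hyperplane)
    then have "(1, x) \<notin> span Z" using kx by auto
    moreover have "span Z \<subseteq> span (tight l)" by (rule span_mono) (auto simp: Z_def)
    ultimately have "span Z \<subset> span (tight l)" using span_base[OF x] by auto
    then have dimZ: "dim Z < dim (tight l)" by (rule dim_psubset)
    have "Z \<noteq> {}" using k(3) False by (auto simp: Z_def[symmetric])
    \<comment> \<open>Large enough for \<open>k + M *\<^sub>R l\<close> to be nonnegative on all of
      \<open>H\<close>, and not only where \<open>l\<close> is tight; tight points contribute 0,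
      since division by zero gives 0.\<close>
    define M where "M = (\<Sum>h\<in>H. \<bar>k \<bullet> h\<bar> / (l \<bullet> h))"
    define k' where "k' = k + M *\<^sub>R l"
    have lpos: "0 \<le> l \<bullet> h" if "h \<in> H" for h using less.prems(1) that by (simp add: valid_def)
    have "0 \<le> k' \<bullet> h" if h: "h \<in> H" for h
    proof (cases "l \<bullet> h = 0")
      case True
      then show ?thesis using bspec[OF k(1), of h] h by (simp add: k'_def inner_add_left tight_def)
    next
      case False
      then have pos: "0 < l \<bullet> h" using lpos[OF h] by simp
      have "\<bar>k \<bullet> h\<bar> / (l \<bullet> h) \<le> M"
        unfolding M_def using h finite_H lpos
        by (intro member_le_sum[where f = "\<lambda>h. \<bar>k \<bullet> h\<bar> / (l \<bullet> h)"] divide_nonneg_nonneg) (simp_all del: split_paired_All)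
      then have "\<bar>k \<bullet> h\<bar> \<le> M * (l \<bullet> h)" using pos by (simp add: pos_divide_le_eq)
      then show ?thesis by (simp add: k'_def inner_add_left)
    qed
    then have k': "valid k'" by (simp add: valid_def)
    have k'l: "k' \<bullet> h = k \<bullet> h" if "h \<in> tight l" for h
      using that by (simp add: k'_def inner_add_left tight_def)
    have tight: "tight (l + k') = Z"
      unfolding tight_add[OF less.prems(1) k'] using k'l by (auto simp: Z_def tight_def)
    obtain x' where x': "(1, x') \<in> Z" using \<open>Z \<noteq> {}\<close> by (auto simp: Z_def tight_def H_def)
    then obtain Y' where Y': "Y' \<in> Q" "\<pi> Y' = x'" using point_lift by (auto simp: Z_def tight_def)
    have "Y' \<in> face (l + k')"
      using Y' x' unfolding tight[symmetric] by (auto simp: face_def eval_at_def tight_def)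
    moreover have "eval_at k' Y > 0"
      using kx k'l[OF x] Y by (simp add: eval_at_def)
    ultimately have "dim (common_null (face l)) < dim (common_null (face (l + k')))"
      using dim_common_null_less[OF less.prems(1) k'] Yl by blast
    moreover have "dim (common_null (face (l + k'))) + dim Z \<le> CARD('m)"
      using less.hyps[of "l + k'"] dimZ valid_add[OF less.prems(1) k'] \<open>Z \<noteq> {}\<close> by (simp add: tight)
    ultimately show ?thesis using k(3) by (simp add: Z_def)
  qed
qed

text \<open>Let \<open>Z\<close> be generic in the face and \<open>u\<close> span its null space. A
  move away from \<open>Z\<close> stays psd for a short time if the form of the direction is
  positive at \<open>u\<close>, and validity then bounds \<open>eval_at l\<close> from below. So a
  positive combination of values at \<open>u\<close> entails a nonnegative combination of values of
  \<open>l\<close>, which forces the two to be proportional.\<close>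

lemma face_rank_one:
  assumes l: "valid l" and ne: "face l \<noteq> {}" and dim: "dim (common_null (face l)) = 1"
  obtains c u where "0 \<le> c" "\<And>Y. Y \<in> Q \<Longrightarrow> eval_at l Y = c * (u \<bullet> (Y *v u))"
proof -
  obtain Z where Z: "Z \<in> face l" "null_space Z = common_null (face l)"
    using face_generic[OF ne] by blast
  have ZQ: "Z \<in> Q" and Z0: "eval_at l Z = 0" using Z(1) by (auto simp: face_def)
  obtain u where u: "null_space Z \<subseteq> span {u}" "u \<in> null_space Z"
  proof -
    obtain B where B: "B \<subseteq> null_space Z" "independent B" "null_space Z \<subseteq> span B" "card B = dim (null_space Z)"
      using basis_exists by blast
    then obtain u where "B = {u}" using dim Z(2) by (metis card_1_singletonE)
    then show thesis using that B by auto
  qed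
  have Zu: "Z *v u = 0" using u(2) by (simp add: null_space_def)
  define q where "q Y = u \<bullet> (Y *v u)" for Y
  have q0: "0 \<le> q Y" if "Y \<in> Q" for Y using Q_psd[OF that] by (simp add: q_def psd_def)
  have key: "0 \<le> a * eval_at l X + b * eval_at l Y"
    if XY: "X \<in> Q" "Y \<in> Q" and D: "((a *\<^sub>R X + b *\<^sub>R Y) *v u = 0) \<or> 0 < a * q X + b * q Y" for X Y a b
  proof -
    define D where "D = a *\<^sub>R (X - Z) + b *\<^sub>R (Y - Z)"
    have Du: "D *v u = (a *\<^sub>R X + b *\<^sub>R Y) *v u"
      using Zu by (simp add: D_def matrix_vec_simps matrix_vector_mult_diff_rdistrib)
    have qD: "u \<bullet> (D *v u) = a * q X + b * q Y"
      unfolding Du by (simp add: q_def matrix_vec_simps inner_add_right)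
    \<comment> \<open>On the line spanned by \<open>u\<close> the condition of
      \<open>psd_perturb\<close> holds with equality for this constant; if \<open>D\<close>
      annihilates \<open>u\<close>, both sides are 0.\<close>
    define \<delta> where "\<delta> = (if D *v u = 0 then 1 else (u \<bullet> (D *v u)) / ((D *v u) \<bullet> (D *v u)))"
    have \<delta>: "\<delta> > 0" "\<delta> * ((D *v u) \<bullet> (D *v u)) = u \<bullet> (D *v u)"
      using that(3) unfolding Du[symmetric] qD[symmetric] by (auto simp: \<delta>_def)
    have "\<delta> * ((D *v s) \<bullet> (D *v s)) \<le> s \<bullet> (D *v s)" if "s \<in> null_space Z" for s
    proof -
      obtain t where "s = t *\<^sub>R u" using u(1) \<open>s \<in> null_space Z\<close> by (auto simp: span_singleton)
      then show ?thesis using \<delta>(2) by (simp add: matrix_vector_mult_scaleR mult.left_commute[of \<delta>])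
    qed
    moreover have "transpose D = D"
      using Q_psd[OF ZQ] Q_psd[OF XY(1)] Q_psd[OF XY(2)]
      by (simp add: D_def psd_def transpose_add transpose_scale transpose_diff)
    ultimately obtain \<epsilon> where \<epsilon>: "\<epsilon> > 0" "psd (Z + \<epsilon> *\<^sub>R D)"
      using psd_perturb[OF Q_psd[OF ZQ] _ \<delta>(1), of D] by blast
    have eq: "Z + \<epsilon> *\<^sub>R D = Z + (\<epsilon> * a) *\<^sub>R (X - Z) + (\<epsilon> * b) *\<^sub>R (Y - Z)"
      by (simp add: D_def scaleR_add_right)
    have "Z + \<epsilon> *\<^sub>R D \<in> Q"
      using \<epsilon>(2) L_affine[OF Q_L[OF XY(1)] Q_L[OF XY(2)] Q_L[OF ZQ]] unfolding eq by (simp add: Q_def)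
    then have "0 \<le> eval_at l (Z + \<epsilon> *\<^sub>R D)" by (rule eval_at_nonneg[OF l])
    also have "\<dots> = \<epsilon> * (a * eval_at l X + b * eval_at l Y)"
      unfolding eq eval_at_affine by (simp add: Z0 algebra_simps)
    finally show ?thesis using \<epsilon>(1) by (simp add: zero_le_mult_iff)
  qed
  have null_q: "eval_at l Y = 0" if "Y \<in> Q" "q Y = 0" for Y
  proof -
    have "u \<in> null_space Y" using psd_null[OF Q_psd[OF that(1)], of u] that(2) by (simp add: q_def)
    then have "0 \<le> (-1) * eval_at l Y + 0 * eval_at l Y"
      using that(1) by (intro key) (auto simp: null_space_def matrix_vec_simps matrix_minus_vec)
    then show ?thesis using eval_at_nonneg[OF l that(1)] by simp
  qed
  have le: "q X * eval_at l Y \<le> q Y * eval_at l X" if XY: "X \<in> Q" "Y \<in> Q" for X Y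
  proof (cases "q X = 0 \<or> q Y = 0")
    case True
    then show ?thesis using null_q[OF XY(1)] null_q[OF XY(2)] q0 XY by auto
  next
    case False
    then have qpos: "q X > 0" "q Y > 0" using q0[OF XY(1)] q0[OF XY(2)] by auto
    have "q X * eval_at l Y \<le> (q Y + t) * eval_at l X" if "t > 0" for t
    proof -
      \<comment> \<open>The coefficients \<open>q Y\<close> and \<open>- q X\<close> would make the
        combination exactly 0, which \<open>key\<close> does not admit; the excess \<open>t\<close>
        makes it positive and is sent to 0 afterwards.\<close>
      have "0 < (q Y + t) * q X + (- q X) * q Y" using qpos that by (simp add: algebra_simps)
      then have "0 \<le> (q Y + t) * eval_at l X + (- q X) * eval_at l Y"
        using XY by (intro key) auto
      then show ?thesis by simp
    qed
    then have "\<forall>\<^sub>F t in at_right 0. q X * eval_at l Y \<le> (q Y + t) * eval_at l X"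
      by (auto intro: eventually_mono[OF eventually_at_right_less])
    moreover have "((\<lambda>t. (q Y + t) * eval_at l X) \<longlongrightarrow> (q Y + 0) * eval_at l X) (at_right 0)"
      by (intro tendsto_intros)
    ultimately have "q X * eval_at l Y \<le> (q Y + 0) * eval_at l X"
      by (intro tendsto_lowerbound) auto
    then show ?thesis by simp
  qed
  show thesis
  proof (cases "\<exists>X\<in>Q. q X \<noteq> 0")
    case True
    then obtain X where X: "X \<in> Q" "q X > 0" using q0 by force
    have "eval_at l Y = (eval_at l X / q X) * q Y" if "Y \<in> Q" for Y
    proof -
      have "q X * eval_at l Y = q Y * eval_at l X"
        using le[OF X(1) that] le[OF that X(1)] by simp
      then show ?thesis using X(2) by (simp add: field_simps)
    qed
    moreover have "0 \<le> eval_at l X / q X" using X eval_at_nonneg[OF l X(1)] by simp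
    ultimately show thesis using that unfolding q_def by blast
  next
    case False
    then show thesis using that[of 0 u] null_q by auto
  qed
qed

end

section \<open>Lifts by matrices over a finite index type\<close>

text \<open>Models smaller matrices inside a fixed type by zero rows and columns; only the rows are
  mentioned because symmetry gives the columns.\<close>

definition sym_supported :: "'m set \<Rightarrow> (real^'m^'m) set" where
  "sym_supported I = {M. transpose M = M \<and> (\<forall>p q. p \<notin> I \<longrightarrow> M $ p $ q = 0)}"

lemma sym_supported_nth:
  assumes "M \<in> sym_supported I"
  shows "M $ p $ q = M $ q $ p" "q \<notin> I \<Longrightarrow> M $ p $ q = 0"
proof -
  show *: "M $ p $ q = M $ q $ p" for p q
  proof -
    have "M $ p $ q = transpose M $ p $ q" using assms by (simp add: sym_supported_def)
    then show ?thesis by (simp add: transpose_def)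
  qed
  show "q \<notin> I \<Longrightarrow> M $ p $ q = 0"
    using assms by (subst *) (simp add: sym_supported_def)
qed

text \<open>The symmetrisation makes this map linear on all of the matrix space.\<close>

definition to_mat :: "nat \<Rightarrow> (nat \<Rightarrow> 'm) \<Rightarrow> real^'m^'m \<Rightarrow> real mat" where
  "to_mat k g M = Matrix.mat k k (\<lambda>(i, j). (M $ g i $ g j + M $ g j $ g i) / 2)"

definition from_mat :: "nat \<Rightarrow> (nat \<Rightarrow> 'm) \<Rightarrow> real mat \<Rightarrow> real^'m^'m" where
  "from_mat k g A = (\<chi> p q. if p \<in> g ` {..<k} \<and> q \<in> g ` {..<k}
     then A $$ (inv_into {..<k} g p, inv_into {..<k} g q) else 0)"

lemma sym_mats_index:
  assumes "A \<in> sym_mats k" "i < k" "j < k"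
  shows "A $$ (i, j) = A $$ (j, i)"
proof -
  have "transpose_mat A = A" "dim_row A = k" "dim_col A = k" using assms(1) by (auto simp: sym_mats_def)
  then show ?thesis using index_transpose_mat(1)[of i A j] assms(2,3) by simp
qed

lemma sym_matsI:
  assumes "A \<in> carrier_mat k k" "\<And>i j. i < k \<Longrightarrow> j < k \<Longrightarrow> A $$ (i, j) = A $$ (j, i)"
  shows "A \<in> sym_mats k"
  using assms by (auto simp: sym_mats_def intro!: eq_matI)

lemma to_mat_sym: "to_mat k g M \<in> sym_mats k"
  by (auto simp: to_mat_def sym_mats_def add.commute)

lemma to_mat_add: "to_mat k g (M + N) = to_mat k g M + to_mat k g N"
  by (rule eq_matI) (auto simp: to_mat_def add_divide_distrib)

lemma to_mat_scale: "to_mat k g (c *\<^sub>R M) = c \<cdot>\<^sub>m to_mat k g M"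
  by (rule eq_matI) (auto simp: to_mat_def algebra_simps)

lemma from_mat_add:
  "A \<in> sym_mats k \<Longrightarrow> B \<in> sym_mats k \<Longrightarrow> from_mat k g (A + B) = from_mat k g A + from_mat k g B"
  by (auto simp: from_mat_def sym_mats_def Finite_Cartesian_Product.vec_eq_iff
      inv_into_into[of _ _ "{..<k}", unfolded lessThan_iff])

lemma from_mat_scale: "A \<in> sym_mats k \<Longrightarrow> from_mat k g (c \<cdot>\<^sub>m A) = c *\<^sub>R from_mat k g A"
  by (auto simp: from_mat_def sym_mats_def Finite_Cartesian_Product.vec_eq_iff
      inv_into_into[of _ _ "{..<k}", unfolded lessThan_iff])

context
  fixes k :: nat and g :: "nat \<Rightarrow> 'm::finite"
  assumes inj: "inj_on g {..<k}"
begin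

lemma from_mat_nth: "i < k \<Longrightarrow> j < k \<Longrightarrow> from_mat k g A $ g i $ g j = A $$ (i, j)"
  using inj by (simp add: from_mat_def)

lemma from_mat_supported: "A \<in> sym_mats k \<Longrightarrow> from_mat k g A \<in> sym_supported (g ` {..<k})"
  by (auto simp: sym_supported_def from_mat_def transpose_def Finite_Cartesian_Product.vec_eq_iff
      inv_into_into[of _ _ "{..<k}", unfolded lessThan_iff] intro!: sym_mats_index)

lemma to_mat_from_mat:
  assumes "A \<in> sym_mats k" shows "to_mat k g (from_mat k g A) = A"
proof (rule eq_matI)
  fix i j assume "i < dim_row A" "j < dim_col A"
  then have "i < k" "j < k" using assms by (auto simp: sym_mats_def)
  then show "to_mat k g (from_mat k g A) $$ (i, j) = A $$ (i, j)"
    using sym_mats_index[OF assms, of i j] by (simp add: to_mat_def from_mat_nth)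
qed (use assms in \<open>auto simp: to_mat_def sym_mats_def\<close>)

lemma from_mat_to_mat:
  assumes "M \<in> sym_supported (g ` {..<k})" shows "from_mat k g (to_mat k g M) = M"
proof -
  have "from_mat k g (to_mat k g M) $ p $ q = M $ p $ q" for p q
  proof (cases "p \<in> g ` {..<k} \<and> q \<in> g ` {..<k}")
    case True
    then obtain i j where "p = g i" "q = g j" "i < k" "j < k" by auto
    then show ?thesis
      using sym_supported_nth(1)[OF assms, of p q] by (simp add: from_mat_nth) (simp add: to_mat_def)
  next
    case False
    then have "M $ p $ q = 0"
      using sym_supported_nth(2)[OF assms, of q p] assms by (auto simp: sym_supported_def)
    then show ?thesis using False by (auto simp: from_mat_def)
  qed
  then show ?thesis by (simp add: Finite_Cartesian_Product.vec_eq_iff)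
qed

lemma to_mat_quadratic_form:
  assumes M: "M \<in> sym_supported (g ` {..<k})"
  defines "w \<equiv> \<lambda>v::real^'m. Matrix.vec k (\<lambda>i. v $ g i)"
  shows "scalar_prod (w v) (to_mat k g M *\<^sub>v w v) = v \<bullet> (M *v v)"
proof -
  let ?I = "g ` {..<k}"
  have "v \<bullet> (M *v v) = (\<Sum>p\<in>UNIV. \<Sum>q\<in>UNIV. v $ p * (M $ p $ q * v $ q))"
    by (simp add: inner_vec_def matrix_vector_mult_def sum_distrib_left)
  also have "\<dots> = (\<Sum>p\<in>?I. \<Sum>q\<in>UNIV. v $ p * (M $ p $ q * v $ q))"
    using M by (intro sum.mono_neutral_right) (auto simp: sym_supported_def)
  also have "\<dots> = (\<Sum>p\<in>?I. \<Sum>q\<in>?I. v $ p * (M $ p $ q * v $ q))"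
    using sym_supported_nth(2)[OF M] by (intro sum.cong refl sum.mono_neutral_right) auto
  also have "\<dots> = (\<Sum>i<k. \<Sum>j<k. v $ g i * (M $ g i $ g j * v $ g j))"
    using inj by (simp add: sum.reindex)
  also have "\<dots> = scalar_prod (w v) (to_mat k g M *\<^sub>v w v)"
    unfolding scalar_prod_def w_def
    by (auto simp: to_mat_def scalar_prod_def sum_distrib_left lessThan_atLeast0
        sym_supported_nth(1)[OF M, of "g _" "g _"] intro!: sum.cong)
  finally show ?thesis by simp
qed

lemma psd_iff_to_mat:
  assumes M: "M \<in> sym_supported (g ` {..<k})"
  shows "psd M \<longleftrightarrow> to_mat k g M \<in> psd_cone k"
proof
  assume *: "psd M"
  have "0 \<le> scalar_prod w (to_mat k g M *\<^sub>v w)" if w: "w \<in> carrier_vec k" for w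
  proof -
    define v :: "real^'m" where "v = (\<chi> p. vec_index w (inv_into {..<k} g p))"
    have "Matrix.vec k (\<lambda>i. v $ g i) = w" using w inj by (intro eq_vecI) (auto simp: v_def)
    then show ?thesis using to_mat_quadratic_form[OF M, of v] * by (simp add: psd_def)
  qed
  then show "to_mat k g M \<in> psd_cone k" by (simp add: psd_cone_def to_mat_sym)
next
  assume *: "to_mat k g M \<in> psd_cone k"
  have "0 \<le> v \<bullet> (M *v v)" for v
    using * unfolding to_mat_quadratic_form[OF M, symmetric] psd_cone_def by auto
  then show "psd M" using M by (simp add: psd_def sym_supported_def)
qed

text \<open>Transfers lifts of variable size to a type on which affine sets, linear maps and
  dimension are available. Injectivity of \<open>g\<close> restricts this to sizes that fit into the
  type.\<close>

lemma has_psd_lift_iff: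
  fixes P :: "'v::real_vector set"
  shows "has_psd_lift k P \<longleftrightarrow>
    (\<exists>L \<pi>. affine L \<and> L \<subseteq> sym_supported (g ` {..<k}) \<and> linear \<pi> \<and> P = \<pi> ` {Y \<in> L. psd Y})"
proof
  assume "has_psd_lift k P"
  then obtain L f where L: "affine_subspace_sym k L" and f: "linear_on_sym k f"
    and P: "P = f ` (psd_cone k \<inter> L)"
    unfolding has_psd_lift_def by blast
  define L' where "L' = {M \<in> sym_supported (g ` {..<k}). to_mat k g M \<in> L}"
  have "affine L'"
    unfolding affine_def
  proof (intro ballI allI impI)
    fix X Y and u v :: real assume XY: "X \<in> L'" "Y \<in> L'" "u + v = 1"
    then have "u \<cdot>\<^sub>m to_mat k g X + v \<cdot>\<^sub>m to_mat k g Y \<in> L"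
      using L unfolding affine_subspace_sym_def L'_def by blast
    then show "u *\<^sub>R X + v *\<^sub>R Y \<in> L'"
      using XY by (auto simp: L'_def sym_supported_def to_mat_add to_mat_scale transpose_add transpose_scale)
  qed
  moreover have "linear (f \<circ> to_mat k g)"
    using f to_mat_sym[of k g] by (intro linearI) (auto simp: linear_on_sym_def to_mat_add to_mat_scale)
  moreover have "P = (f \<circ> to_mat k g) ` {Y \<in> L'. psd Y}"
  proof -
    have "psd_cone k \<inter> L = to_mat k g ` {Y \<in> L'. psd Y}"
    proof (intro equalityI subsetI)
      fix A assume A: "A \<in> psd_cone k \<inter> L"
      then have "A \<in> sym_mats k" by (simp add: psd_cone_def)
      note AA = to_mat_from_mat[OF this] from_mat_supported[OF this]
      then have "from_mat k g A \<in> {Y \<in> L'. psd Y}"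
        using A psd_iff_to_mat[OF AA(2)] by (simp add: L'_def)
      then show "A \<in> to_mat k g ` {Y \<in> L'. psd Y}" using AA(1) by (metis imageI)
    qed (auto simp: L'_def psd_iff_to_mat)
    then show ?thesis unfolding P by (simp add: image_comp)
  qed
  ultimately show "\<exists>L \<pi>. affine L \<and> L \<subseteq> sym_supported (g ` {..<k}) \<and> linear \<pi> \<and> P = \<pi> ` {Y \<in> L. psd Y}"
    by (intro exI[of _ L'] exI[of _ "f \<circ> to_mat k g"]) (auto simp: L'_def)
next
  assume "\<exists>L \<pi>. affine L \<and> L \<subseteq> sym_supported (g ` {..<k}) \<and> linear \<pi> \<and> P = \<pi> ` {Y \<in> L. psd Y}"
  then obtain L and \<pi> :: "real^'m^'m \<Rightarrow> 'v" where L: "affine L" "L \<subseteq> sym_supported (g ` {..<k})"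
    and \<pi>: "linear \<pi>" and P: "P = \<pi> ` {Y \<in> L. psd Y}" by blast
  define L' where "L' = {A \<in> sym_mats k. from_mat k g A \<in> L}"
  have comb: "u \<cdot>\<^sub>m X + v \<cdot>\<^sub>m Y \<in> sym_mats k" "u \<cdot>\<^sub>m X \<in> sym_mats k"
    if "X \<in> sym_mats k" "Y \<in> sym_mats k" for X Y u v
  proof -
    have "X \<in> carrier_mat k k" "Y \<in> carrier_mat k k" using that by (auto simp: sym_mats_def)
    then show "u \<cdot>\<^sub>m X + v \<cdot>\<^sub>m Y \<in> sym_mats k" "u \<cdot>\<^sub>m X \<in> sym_mats k"
      using sym_mats_index[OF that(1)] sym_mats_index[OF that(2)] by (auto intro!: sym_matsI)
  qed
  have "affine_subspace_sym k L'"
    unfolding affine_subspace_sym_def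
  proof (intro conjI ballI allI impI)
    fix X Y and u v :: real assume XY: "X \<in> L'" "Y \<in> L'" "u + v = 1"
    then have s: "X \<in> sym_mats k" "Y \<in> sym_mats k" by (auto simp: L'_def)
    have "from_mat k g (u \<cdot>\<^sub>m X + v \<cdot>\<^sub>m Y) = u *\<^sub>R from_mat k g X + v *\<^sub>R from_mat k g Y"
      using s comb by (simp add: from_mat_add from_mat_scale)
    then show "u \<cdot>\<^sub>m X + v \<cdot>\<^sub>m Y \<in> L'"
      using XY comb(1)[OF s] L(1) by (auto simp: L'_def affine_def)
  qed (auto simp: L'_def)
  moreover have "linear_on_sym k (\<pi> \<circ> from_mat k g)"
    unfolding linear_on_sym_def
    by (auto simp: from_mat_add from_mat_scale linear_add[OF \<pi>] linear_scale[OF \<pi>])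
  moreover have "P = (\<pi> \<circ> from_mat k g) ` (psd_cone k \<inter> L')"
  proof -
    have "{Y \<in> L. psd Y} = from_mat k g ` (psd_cone k \<inter> L')"
    proof (intro equalityI subsetI)
      fix Y assume Y: "Y \<in> {Y \<in> L. psd Y}"
      then have s: "Y \<in> sym_supported (g ` {..<k})" using L(2) by auto
      have "to_mat k g Y \<in> psd_cone k \<inter> L'"
        using Y psd_iff_to_mat[OF s] from_mat_to_mat[OF s] to_mat_sym by (simp add: L'_def)
      then show "Y \<in> from_mat k g ` (psd_cone k \<inter> L')" using from_mat_to_mat[OF s] by (metis imageI)
    next
      fix Y assume "Y \<in> from_mat k g ` (psd_cone k \<inter> L')"
      then obtain A where A: "A \<in> psd_cone k" "A \<in> L'" "Y = from_mat k g A" by blast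
      then have "A \<in> sym_mats k" by (simp add: psd_cone_def)
      then show "Y \<in> {Y \<in> L. psd Y}"
        using A psd_iff_to_mat[OF from_mat_supported] by (simp add: L'_def to_mat_from_mat)
    qed
    then show ?thesis unfolding P by (simp add: image_comp)
  qed
  ultimately show "has_psd_lift k P" unfolding has_psd_lift_def by blast
qed

end

section \<open>Perfect graphs and the clique constrained stable set polytope\<close>

lemma simple_graph_neq: "simple_graph V E \<Longrightarrow> {i, j} \<in> E \<Longrightarrow> i \<noteq> j"
  by (force simp: simple_graph_def)

lemma simple_graph_induced: "simple_graph V E \<Longrightarrow> W \<subseteq> V \<Longrightarrow> simple_graph W (induced_edges E W)"
  by (auto simp: simple_graph_def induced_edges_def intro: finite_subset)

lemma clique_induced_iff: "W \<subseteq> V \<Longrightarrow> clique W (induced_edges E W) C \<longleftrightarrow> C \<subseteq> W \<and> clique V E C"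
  by (auto simp: clique_def induced_edges_def)

lemma clique_stable_card_le_one:
  assumes "clique V E C" "stable_set V E S"
  shows "card (C \<inter> S) \<le> 1"
proof (cases "finite (C \<inter> S)")
  case True
  have "a = b" if "a \<in> C \<inter> S" "b \<in> C \<inter> S" for a b
    using that assms unfolding clique_def stable_set_def by blast
  then show ?thesis using card_le_Suc0_iff_eq[OF True] by auto
qed simp

lemma finite_clique_cards: "finite V \<Longrightarrow> finite (card ` {C. clique V E C})"
  by (rule finite_imageI, rule finite_subset[of _ "Pow V"]) (auto simp: clique_def)

lemma card_le_clique_number: "finite V \<Longrightarrow> clique V E C \<Longrightarrow> card C \<le> clique_number V E"
  unfolding clique_number_def by (intro Max_ge finite_clique_cards) auto

lemma clique_number_attained:
  assumes "finite V"
  obtains C where "clique V E C" "card C = clique_number V E"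
proof -
  have "clique V E {}" by (simp add: clique_def)
  then have "clique_number V E \<in> card ` {C. clique V E C}"
    unfolding clique_number_def by (intro Max_in finite_clique_cards assms) auto
  then show thesis using that by auto
qed

text \<open>An injective numbering of the vertices is a proper colouring, so the minimum is over a
  nonempty set.\<close>

lemma chromatic_number_attained:
  assumes "simple_graph V E"
  obtains c where "proper_colouring V E (chromatic_number V E) c"
proof -
  obtain h where h: "bij_betw h V {0..<card V}"
    using ex_bij_betw_finite_nat[of V] assms by (auto simp: simple_graph_def)
  have "proper_colouring V E (card V) h"
    unfolding proper_colouring_def
  proof (intro conjI ballI impI)
    show "h ` V \<subseteq> {..<card V}" using h by (auto simp: bij_betw_def)
    fix i j assume "i \<in> V" "j \<in> V" "{i, j} \<in> E"
    moreover from this(3) have "i \<noteq> j" by (rule simple_graph_neq[OF assms])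
    ultimately show "h i \<noteq> h j"
      by (simp add: inj_on_eq_iff[OF bij_betw_imp_inj_on[OF h]])
  qed
  then have "\<exists>c. proper_colouring V E (chromatic_number V E) c"
    unfolding chromatic_number_def by (intro LeastI[of "\<lambda>k. \<exists>c. proper_colouring V E k c"]) auto
  then show thesis using that by auto
qed

lemma clique_number_le_chromatic_number:
  assumes "simple_graph V E"
  shows "clique_number V E \<le> chromatic_number V E"
proof -
  have fin: "finite V" using assms by (simp add: simple_graph_def)
  obtain C where C: "clique V E C" "card C = clique_number V E"
    using clique_number_attained[OF fin] by blast
  obtain c where c: "proper_colouring V E (chromatic_number V E) c"
    using chromatic_number_attained[OF assms] by blast
  have "inj_on c C"
  proof (rule inj_onI, rule ccontr)
    fix x y assume "x \<in> C" "y \<in> C" "c x = c y" "x \<noteq> y"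
    then show False using C(1) c unfolding proper_colouring_def clique_def by blast
  qed
  moreover have "c ` C \<subseteq> {..<chromatic_number V E}"
    using C(1) c unfolding proper_colouring_def clique_def by blast
  ultimately have "card C \<le> card {..<chromatic_number V E}" by (intro card_inj_on_le) auto
  then show ?thesis using C(2) by simp
qed

section \<open>From perfectness to \<open>QSTAB E \<subseteq> STAB E\<close>: weighted covers by
  stable sets\<close>

definition QSTAB :: "'n::finite set set \<Rightarrow> (real^'n) set" where
  "QSTAB E = {x. (\<forall>i. 0 \<le> x $ i) \<and> (\<forall>C. clique UNIV E C \<longrightarrow> (\<Sum>i\<in>C. x $ i) \<le> 1)}"

text \<open>Double counting of the incidences between vertices of \<open>C\<close> and list
  entries.\<close>

lemma sum_length_filter:
  assumes "finite C"
  shows "(\<Sum>v\<in>C. length (filter (\<lambda>S. v \<in> S) Ss)) = (\<Sum>S\<leftarrow>Ss. card (C \<inter> S))"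
proof (induction Ss)
  case (Cons S Ss)
  have "(\<Sum>v\<in>C. length (filter (\<lambda>S. v \<in> S) (S # Ss))) =
    (\<Sum>v\<in>C. (if v \<in> S then 1 else 0) + length (filter (\<lambda>S. v \<in> S) Ss))"
    by (rule sum.cong) auto
  then show ?case using Cons assms by (simp add: sum.distrib sum.If_cases Int_def)
qed simp

text \<open>Weights 0 and 1 select an induced subgraph; its colour classes form the cover, padded
  with empty sets to the prescribed length. Lists are used because larger weights need repeated
  sets.\<close>

lemma cover_zero_one:
  fixes w :: "'n::finite \<Rightarrow> nat"
  assumes G: "simple_graph UNIV E" and perf: "perfect_graph UNIV E"
    and N: "\<And>C. clique UNIV E C \<Longrightarrow> sum w C \<le> N" and w: "\<And>v. w v \<le> 1"
  shows "\<exists>Ss. length Ss = N \<and> (\<forall>S\<in>set Ss. stable_set UNIV E S) \<and>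
    (\<forall>v. length (filter (\<lambda>S. v \<in> S) Ss) = w v)"
proof -
  define W where "W = {v. w v = 1}"
  define k where "k = clique_number W (induced_edges E W)"
  obtain C where C: "clique W (induced_edges E W) C" "card C = k"
    using clique_number_attained[of W] unfolding k_def by auto
  then have CW: "C \<subseteq> W" "clique UNIV E C" using clique_induced_iff[of W UNIV E C] by auto
  have "sum w C = card C" using CW(1) by (subst card_eq_sum, intro sum.cong) (auto simp: W_def)
  then have kN: "k \<le> N" using N[OF CW(2)] C(2) by simp
  have "chromatic_number W (induced_edges E W) = k" using perf by (simp add: perfect_graph_def k_def)
  then obtain c where c: "proper_colouring W (induced_edges E W) k c"
    using chromatic_number_attained[OF simple_graph_induced[OF G, of W]] by auto
  define Ss where "Ss = map (\<lambda>i. {v \<in> W. c v = i}) [0..<k] @ replicate (N - k) {}"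
  have "length Ss = N" using kN by (simp add: Ss_def)
  moreover have "stable_set UNIV E S" if "S \<in> set Ss" for S
    using that c by (fastforce simp: Ss_def stable_set_def proper_colouring_def induced_edges_def)
  moreover have "length (filter (\<lambda>S. v \<in> S) Ss) = w v" for v
  proof -
    have "length (filter (\<lambda>S. v \<in> S) Ss) = length (filter (\<lambda>i. v \<in> W \<and> c v = i) [0..<k])"
      by (simp add: Ss_def filter_map o_def)
    also have "\<dots> = card ({i. v \<in> W \<and> c v = i} \<inter> set [0..<k])"
      by (subst distinct_length_filter) auto
    also have "{i. v \<in> W \<and> c v = i} \<inter> set [0..<k] = (if v \<in> W then {c v} else {})"
      using c by (auto simp: proper_colouring_def)
    also have "card \<dots> = w v" using w[of v] by (auto simp: W_def)
    finally show ?thesis .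
  qed
  ultimately show ?thesis by blast
qed

text \<open>If some weight exceeds one, lower it at \<open>v\<close>, take a stable set \<open>S\<close> through \<open>v\<close> from the resulting
  cover, and lower the original weights along \<open>S\<close>: a clique of weight \<open>N\<close> before the second step
  meets all members of the cover and avoids \<open>v\<close>, hence loses weight.\<close>

lemma weighted_cover:
  fixes w :: "'n::finite \<Rightarrow> nat"
  assumes G: "simple_graph UNIV E" and perf: "perfect_graph UNIV E"
    and N: "\<And>C. clique UNIV E C \<Longrightarrow> sum w C \<le> N"
  shows "\<exists>Ss. length Ss = N \<and> (\<forall>S\<in>set Ss. stable_set UNIV E S) \<and>
    (\<forall>v. length (filter (\<lambda>S. v \<in> S) Ss) = w v)"
  using N
proof (induction "sum w UNIV" arbitrary: w N rule: less_induct)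
  case less
  show ?case
  proof (cases "\<forall>v. w v \<le> 1")
    case True
    then show ?thesis using cover_zero_one[OF G perf less.prems] by blast
  next
    case False
    then obtain v where "\<not> w v \<le> 1" by blast
    then have v: "w v \<ge> 2" by simp
    define w' where "w' u = (if u = v then w v - 1 else w u)" for u
    have w'le: "w' u \<le> w u" for u by (simp add: w'_def)
    have "sum w' UNIV < sum w UNIV"
      by (rule sum_strict_mono_ex1) (use v in \<open>auto simp: w'_def\<close>)
    moreover have bound': "sum w' C \<le> N" if "clique UNIV E C" for C
      using sum_mono[of C w' w] w'le less.prems[OF that] by (meson order_trans)
    ultimately obtain Ss where Ss: "length Ss = N" "\<forall>S\<in>set Ss. stable_set UNIV E S"
      "\<forall>u. length (filter (\<lambda>S. u \<in> S) Ss) = w' u"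
      using less.hyps[of w' N] by blast
    have "length (filter (\<lambda>S. v \<in> S) Ss) > 0" using Ss(3) v by (simp add: w'_def)
    then obtain S where S: "S \<in> set Ss" "v \<in> S" by (auto simp: length_greater_0_conv filter_empty_conv)
    have pos: "w' u \<ge> 1" if "u \<in> S" for u
    proof -
      have "S \<in> set (filter (\<lambda>S. u \<in> S) Ss)" using S(1) that by simp
      then have "length (filter (\<lambda>S. u \<in> S) Ss) > 0" by (metis length_pos_if_in_set)
      then show ?thesis using Ss(3) by (simp add: Suc_le_eq)
    qed
    \<comment> \<open>The weight at \<open>v\<close> was already lowered in \<open>w'\<close>, so
      \<open>v\<close> is left out here; in total the weights drop by one exactly on
      \<open>S\<close>.\<close>
    define w'' where "w'' u = (if u \<in> S - {v} then w' u - 1 else w' u)" for u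
    have w''le: "w'' u \<le> w' u" for u by (simp add: w''_def)
    have "clique UNIV E {v}" by (simp add: clique_def)
    then have N2: "N \<ge> 2" using less.prems[of "{v}"] v by simp
    have "sum w'' UNIV \<le> sum w' UNIV" using w''le by (rule sum_mono)
    then have "sum w'' UNIV < sum w UNIV" using \<open>sum w' UNIV < sum w UNIV\<close> by simp
    moreover have "sum w'' C \<le> N - 1" if C: "clique UNIV E C" for C
    proof (cases "sum w' C = N")
      case False
      moreover have "sum w'' C \<le> sum w' C" using w''le by (rule sum_mono)
      ultimately show ?thesis using bound'[OF C] by simp
    next
      case True
      \<comment> \<open>A clique through \<open>v\<close> has lost one unit in \<open>w'\<close> and
        cannot still weigh \<open>N\<close>.\<close>
      have "v \<notin> C"
      proof
        assume "v \<in> C"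
        then have "sum w' C < sum w C"
          using v by (intro sum_strict_mono_ex1) (auto simp: w'_def)
        then show False using True less.prems[OF C] by simp
      qed
      have le1: "card (C \<inter> S') \<le> 1" if "S' \<in> set Ss" for S'
        using clique_stable_card_le_one[OF C] Ss(2) that by blast
      \<comment> \<open>The \<open>N\<close> entries of the cover share \<open>N\<close> incidences
        with \<open>C\<close>, at most one each, so none can miss \<open>C\<close>.\<close>
      have "C \<inter> S \<noteq> {}"
      proof
        assume "C \<inter> S = {}"
        obtain As Bs where AB: "Ss = As @ S # Bs" using S(1) by (auto dest: split_list)
        have le: "(\<Sum>S'\<leftarrow>Xs. card (C \<inter> S')) \<le> length Xs" if "set Xs \<subseteq> set Ss" for Xs
          using sum_list_mono[of Xs "\<lambda>S'. card (C \<inter> S')" "\<lambda>_. 1"] le1 that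
          by (auto simp: sum_list_triv)
        have "(\<Sum>S'\<leftarrow>Ss. card (C \<inter> S')) \<le> length As + length Bs"
          using add_mono[OF le[of As] le[of Bs]] \<open>C \<inter> S = {}\<close>
          by (simp add: AB subset_insertI2)
        also have "\<dots> < N" using Ss(1) AB by simp
        finally show False using sum_length_filter[of C Ss] Ss(3) True by simp
      qed
      then obtain u where u: "u \<in> C" "u \<in> S" by blast
      then have "sum w'' C < sum w' C"
        using pos[OF u(2)] \<open>v \<notin> C\<close> by (intro sum_strict_mono_ex1) (auto simp: w''_def intro!: bexI[of _ u])
      then show ?thesis using True by simp
    qed
    ultimately obtain Ts where Ts: "length Ts = N - 1" "\<forall>S\<in>set Ts. stable_set UNIV E S"
      "\<forall>u. length (filter (\<lambda>S. u \<in> S) Ts) = w'' u"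
      using less.hyps[of w'' "N - 1"] by blast
    have "length (filter (\<lambda>S. u \<in> S) (S # Ts)) = w u" for u
      using Ts(3) pos[of u] v S(2) by (auto simp: w''_def w'_def)
    then show ?thesis
      using Ts(1,2) Ss(2) S(1) N2 by (intro exI[of _ "S # Ts"]) auto
  qed
qed

lemma closed_STAB: "closed (STAB E)"
  unfolding STAB_def by (intro compact_imp_closed compact_convex_hull finite_imp_compact) simp

text \<open>Rounding down a large multiple of \<open>x\<close> gives integral weights whose cover
  writes a nearby point as an average of characteristic vectors of stable sets. These points
  converge to \<open>x\<close>, and \<open>STAB E\<close> is closed.\<close>

lemma perfect_imp_QSTAB_subset_STAB:
  fixes E :: "'n::finite set set"
  assumes G: "simple_graph UNIV E" and perf: "perfect_graph UNIV E"
  shows "QSTAB E \<subseteq> STAB E"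
proof
  fix x assume x: "x \<in> QSTAB E"
  then have x0: "0 \<le> x $ i" for i by (simp add: QSTAB_def)
  define w where "w N v = nat \<lfloor>real (Suc N) * x $ v\<rfloor>" for N v
  define y :: "nat \<Rightarrow> real^'n" where "y N = (\<chi> v. real (w N v) / real (Suc N))" for N
  have w: "real (w N v) \<le> real (Suc N) * x $ v" "real (Suc N) * x $ v - 1 \<le> real (w N v)" for N v
    using x0[of v] unfolding w_def by (subst of_nat_nat; simp; linarith)+
  have "y N \<in> STAB E" for N
  proof -
    have "sum (w N) C \<le> Suc N" if "clique UNIV E C" for C
    proof -
      have "real (sum (w N) C) \<le> (\<Sum>v\<in>C. real (Suc N) * x $ v)"
        unfolding of_nat_sum by (intro sum_mono w)
      also have "\<dots> = real (Suc N) * (\<Sum>v\<in>C. x $ v)" by (simp add: sum_distrib_left)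
      also have "\<dots> \<le> real (Suc N) * 1" using x that by (intro mult_left_mono) (auto simp: QSTAB_def)
      finally show ?thesis by (simp only: mult_1_right of_nat_le_iff)
    qed
    then obtain Ss where Ss: "length Ss = Suc N" "\<forall>S\<in>set Ss. stable_set UNIV E S"
      "\<forall>v. length (filter (\<lambda>S. v \<in> S) Ss) = w N v"
      using weighted_cover[OF G perf] by blast
    have "(\<Sum>i<Suc N. (1 / real (Suc N)) *\<^sub>R char_vec (Ss ! i)) \<in> STAB E"
    proof (rule convex_sum)
      fix i assume "i \<in> {..<Suc N}"
      then show "char_vec (Ss ! i) \<in> STAB E"
        using Ss unfolding STAB_def by (intro hull_inc) auto
    qed (auto simp: STAB_def)
    moreover have "(\<Sum>i<Suc N. (1 / real (Suc N)) *\<^sub>R char_vec (Ss ! i)) = y N"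
    proof -
      have "(\<Sum>i<Suc N. (1 / real (Suc N)) *\<^sub>R char_vec (Ss ! i)) $ v = y N $ v" for v
      proof -
        have "(\<Sum>i<Suc N. (1 / real (Suc N)) *\<^sub>R char_vec (Ss ! i)) $ v =
          (\<Sum>i<Suc N. if v \<in> Ss ! i then 1 else 0) / real (Suc N)"
          by (simp add: char_vec_def sum_divide_distrib del: sum.lessThan_Suc of_nat_Suc cong: if_cong)
        also have "(\<Sum>i<Suc N. if v \<in> Ss ! i then 1 else 0) = real (card {i \<in> {..<Suc N}. v \<in> Ss ! i})"
          by (subst sum.If_cases) (auto simp: Int_def simp del: sum.lessThan_Suc)
        also have "\<dots> = real (w N v)"
          using Ss(1,3) length_filter_conv_card[of "\<lambda>S. v \<in> S" Ss] by (simp del: of_nat_Suc)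
        finally show ?thesis by (simp add: y_def)
      qed
      then show ?thesis by (simp add: Finite_Cartesian_Product.vec_eq_iff)
    qed
    ultimately show ?thesis by simp
  qed
  moreover have "y \<longlonglongrightarrow> x"
  proof (rule vec_tendstoI)
    fix v
    show "(\<lambda>N. y N $ v) \<longlonglongrightarrow> x $ v"
    proof (rule tendsto_sandwich)
      show "\<forall>\<^sub>F N in sequentially. x $ v - 1 / real (Suc N) \<le> y N $ v"
      proof (intro always_eventually allI)
        fix N
        have "(real (Suc N) * x $ v - 1) / real (Suc N) \<le> real (w N v) / real (Suc N)"
          by (intro divide_right_mono w) simp
        then show "x $ v - 1 / real (Suc N) \<le> y N $ v"
          by (simp add: y_def diff_divide_distrib del: of_nat_Suc)
      qed
      show "\<forall>\<^sub>F N in sequentially. y N $ v \<le> x $ v"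
        using w(1)[where v = v]
        by (intro always_eventually allI) (simp add: y_def pos_divide_le_eq mult.commute del: of_nat_Suc)
      show "(\<lambda>N. x $ v - 1 / real (Suc N)) \<longlonglongrightarrow> x $ v"
        using tendsto_diff[OF tendsto_const LIMSEQ_inverse_real_of_nat, of "x $ v"] by (simp add: inverse_eq_divide)
    qed simp
  qed
  ultimately show "x \<in> STAB E" using closed_sequentially[OF closed_STAB] by blast
qed

section \<open>From \<open>QSTAB E \<subseteq> STAB E\<close> back to perfectness\<close>

lemma inner_char_vec: "char_vec C \<bullet> y = (\<Sum>i\<in>C. y $ i)"
proof -
  have "char_vec C \<bullet> y = (\<Sum>i\<in>UNIV. if i \<in> C then y $ i else 0)"
    unfolding inner_vec_def by (rule sum.cong) (auto simp: char_vec_def)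
  then show ?thesis by (simp add: sum.If_cases)
qed

lemma inner_char_vec_char_vec: "char_vec C \<bullet> char_vec S = real (card (C \<inter> S))"
  unfolding inner_char_vec by (simp add: char_vec_def sum.If_cases)

text \<open>The uniform point \<open>1 / \<omega>\<close> on \<open>W\<close> satisfies all maximum clique inequalities with equality.\<close>

lemma stable_set_meeting_maximum_cliques:
  fixes E :: "'n::finite set set"
  assumes sub: "QSTAB E \<subseteq> STAB E" and W: "W \<noteq> {}"
  obtains S where "stable_set UNIV E S"
    "\<And>C. clique W (induced_edges E W) C \<Longrightarrow> card C = clique_number W (induced_edges E W) \<Longrightarrow> C \<inter> S \<noteq> {}"
proof -
  define k where "k = clique_number W (induced_edges E W)"
  define M where "M = {C. clique W (induced_edges E W) C \<and> card C = k}"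
  note clq = clique_induced_iff[of W UNIV E]
  obtain v where v: "v \<in> W" using W by blast
  have "clique W (induced_edges E W) {v}" using v by (simp add: clique_def)
  from card_le_clique_number[OF _ this] have k: "k \<ge> 1" by (simp add: k_def)
  define x :: "real^'n" where "x = (1 / real k) *\<^sub>R char_vec W"
  have x: "(\<Sum>i\<in>C. x $ i) = real (card (C \<inter> W)) / real k" for C
    using inner_char_vec_char_vec[of C W] unfolding inner_char_vec x_def
    by (simp flip: sum_divide_distrib)
  have "x \<in> QSTAB E"
    unfolding QSTAB_def
  proof (intro CollectI conjI allI impI)
    show "0 \<le> x $ i" for i by (simp add: x_def char_vec_def)
    fix C assume "clique UNIV E C"
    then have "clique UNIV E (C \<inter> W)" by (auto simp: clique_def)
    then have "clique W (induced_edges E W) (C \<inter> W)" by (simp add: clq)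
    from card_le_clique_number[OF _ this] show "(\<Sum>i\<in>C. x $ i) \<le> 1"
      using k by (simp add: x k_def[symmetric])
  qed
  then have xS: "x \<in> STAB E" using sub by blast
  \<comment> \<open>The value of \<open>a\<close> at \<open>x\<close> is the number of maximum
    cliques, so some stable set must reach it too; as each clique contributes at most 1 there, all
    of them are met.\<close>
  define a :: "real^'n" where "a = (\<Sum>C\<in>M. char_vec C)"
  have ax: "a \<bullet> x = real (card M)"
  proof -
    have "a \<bullet> x = (\<Sum>C\<in>M. real (card (C \<inter> W)) / real k)"
      by (simp add: a_def inner_sum_left inner_char_vec x)
    also have "\<dots> = (\<Sum>C\<in>M. 1)"
      using k by (intro sum.cong) (auto simp: M_def clq Int_absorb2)
    finally show ?thesis by simp
  qed
  have "\<exists>S. stable_set UNIV E S \<and> real (card M) \<le> a \<bullet> char_vec S"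
  proof (rule ccontr)
    assume "\<not> ?thesis"
    then have "STAB E \<subseteq> {y. a \<bullet> y < real (card M)}"
      unfolding STAB_def by (intro hull_minimal convex_halfspace_lt) (auto simp: not_le)
    then show False using xS ax by auto
  qed
  then obtain S where S: "stable_set UNIV E S" "real (card M) \<le> a \<bullet> char_vec S" by blast
  have le1: "card (C \<inter> S) \<le> 1" if "C \<in> M" for C
    using clique_stable_card_le_one[OF _ S(1)] that by (auto simp: M_def clq)
  have "C \<inter> S \<noteq> {}" if "C \<in> M" for C
  proof
    assume "C \<inter> S = {}"
    have "a \<bullet> char_vec S = (\<Sum>C\<in>M. real (card (C \<inter> S)))"
      by (simp add: a_def inner_sum_left inner_char_vec_char_vec)
    also have "\<dots> < (\<Sum>C\<in>M. 1)"
      using le1 that \<open>C \<inter> S = {}\<close> by (intro sum_strict_mono_ex1) (auto intro!: bexI[of _ C])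
    finally show False using S(2) by simp
  qed
  then show thesis using that[OF S(1)] by (auto simp: M_def k_def)
qed

text \<open>Removing a stable set that meets all maximum cliques lowers the clique number, so the
  removed vertices can share one new colour.\<close>

lemma QSTAB_subset_STAB_imp_perfect:
  fixes E :: "'n::finite set set"
  assumes G: "simple_graph UNIV E" and sub: "QSTAB E \<subseteq> STAB E"
  shows "perfect_graph UNIV E"
proof -
  have col: "\<exists>c. proper_colouring W (induced_edges E W) (clique_number W (induced_edges E W)) c" for W
  proof (induction "card W" arbitrary: W rule: less_induct)
    case less
    define k where "k = clique_number W (induced_edges E W)"
    show ?case
    proof (cases "W = {}")
      case True
      then show ?thesis by (intro exI[of _ "\<lambda>_. 0"]) (simp add: proper_colouring_def)
    next
      case False
      obtain S where S: "stable_set UNIV E S"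
        "\<And>C. clique W (induced_edges E W) C \<Longrightarrow> card C = k \<Longrightarrow> C \<inter> S \<noteq> {}"
        using stable_set_meeting_maximum_cliques[OF sub False] unfolding k_def by blast
      obtain C where C: "clique W (induced_edges E W) C" "card C = k"
        using clique_number_attained[of W] unfolding k_def by auto
      have "W - S \<subset> W" using S(2)[OF C] C(1) by (auto simp: clique_def)
      then have "card (W - S) < card W" by (intro psubset_card_mono) auto
      then obtain c where c: "proper_colouring (W - S) (induced_edges E (W - S))
          (clique_number (W - S) (induced_edges E (W - S))) c"
        using less by blast
      obtain D where D: "clique (W - S) (induced_edges E (W - S)) D"
        "card D = clique_number (W - S) (induced_edges E (W - S))"
        using clique_number_attained[of "W - S"] by auto
      have DW: "clique W (induced_edges E W) D" and DS: "D \<inter> S = {}"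
        using D(1) clique_induced_iff[of W UNIV E] clique_induced_iff[of "W - S" UNIV E] by auto
      have "card D < k"
        using card_le_clique_number[OF _ DW] S(2)[OF DW] DS by (auto simp: k_def[symmetric] le_less)
      then have lt: "clique_number (W - S) (induced_edges E (W - S)) \<le> k - 1" "k \<ge> 1" using D(2) by auto
      define c' where "c' v = (if v \<in> S then k - 1 else c v)" for v
      have cl: "c v < k - 1" if "v \<in> W" "v \<notin> S" for v
        using c that lt(1) by (force simp: proper_colouring_def)
      have "proper_colouring W (induced_edges E W) k c'"
        unfolding proper_colouring_def
      proof (intro conjI ballI impI)
        show "c' ` W \<subseteq> {..<k}" using cl lt(2) by (force simp: c'_def)
        fix i j assume ij: "i \<in> W" "j \<in> W" "{i, j} \<in> induced_edges E W"
        show "c' i \<noteq> c' j"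
        proof (cases "i \<in> S \<or> j \<in> S")
          case True
          moreover have "\<not> (i \<in> S \<and> j \<in> S)" using S(1) ij(3) by (auto simp: stable_set_def induced_edges_def)
          ultimately show ?thesis using cl[of i] cl[of j] ij by (auto simp: c'_def)
        next
          case False
          then have "{i, j} \<in> induced_edges E (W - S)" using ij by (auto simp: induced_edges_def)
          then have "c i \<noteq> c j" using c ij False by (auto simp: proper_colouring_def)
          then show ?thesis using False by (simp add: c'_def)
        qed
      qed
      then show ?thesis unfolding k_def by blast
    qed
  qed
  have "chromatic_number W (induced_edges E W) = clique_number W (induced_edges E W)" for W
  proof (rule antisym)
    show "chromatic_number W (induced_edges E W) \<le> clique_number W (induced_edges E W)"
      unfolding chromatic_number_def using col[of W] by (rule Least_le)
    show "clique_number W (induced_edges E W) \<le> chromatic_number W (induced_edges E W)"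
      using simple_graph_induced[OF G, of W] by (intro clique_number_le_chromatic_number) simp
  qed
  then show ?thesis by (simp add: perfect_graph_def)
qed

section \<open>Lifts of the stable set polytope\<close>

lemma card_compl: "card (- A) = CARD('a::finite) - card (A :: 'a set)"
  by (simp add: Compl_eq_Diff_UNIV card_Diff_subset)

text \<open>The vectors lie in the orthogonal complement of \<open>N\<close>, whose dimension is
  below their number. The statement is about an indexed family, so that equal vectors also count as
  dependent.\<close>

lemma linear_dependence:
  fixes w :: "'k::finite \<Rightarrow> 'a::euclidean_space"
  assumes N: "subspace N" "DIM('a) < dim N + CARD('k)"
    and orth: "\<And>k s. s \<in> N \<Longrightarrow> w k \<bullet> s = 0"
  obtains c where "c \<noteq> 0" "(\<Sum>k\<in>UNIV. c $ k *\<^sub>R w k) = 0"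
proof -
  define F where "F c = (\<Sum>k\<in>UNIV. c $ k *\<^sub>R w k)" for c :: "real^'k"
  have lin: "linear F"
    unfolding F_def by (intro linearI) (simp_all add: scaleR_add_left sum.distrib scaleR_sum_right)
  define N' where "N' = {y \<in> UNIV. \<forall>x\<in>N. Linear_Algebra.orthogonal x y}"
  have "F c \<in> N'" for c
    using orth by (auto simp: N'_def F_def Linear_Algebra.orthogonal_def inner_sum_right inner_commute[of _ "w _"])
  then have "dim (range F) \<le> dim N'" by (intro dim_subset) auto
  also have "dim N' + dim N = DIM('a)"
    using dim_subspace_orthogonal_to_vectors[OF N(1) subspace_UNIV] by (simp add: N'_def)
  then have "dim N' < CARD('k)" using N(2) by simp
  finally have "dim (range F) < dim (UNIV :: (real^'k) set)" by simp
  then have "\<not> inj F" using dim_image_eq[OF lin, of UNIV] by auto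
  then obtain c where "F c = 0" "c \<noteq> 0" using linear_injective_0[OF lin] by blast
  then show thesis using that by (simp add: F_def)
qed

section \<open>Facets of polytopes with a lift of least possible size\<close>

context psd_lifted_polytope
begin

text \<open>At a rank one matrix with form \<open>(w \<bullet> v)\<^sup>2\<close> such a functional
  has the root \<open>sqrt c * (w \<bullet> u)\<close>, which is linear in \<open>w\<close>.\<close>

definition rooted :: "real \<times> 'v \<Rightarrow> bool" where
  "rooted l \<longleftrightarrow> valid l \<and> (\<exists>c u. 0 \<le> c \<and> (\<forall>Y\<in>Q. eval_at l Y = c * (u \<bullet> (Y *v u))))"

text \<open>For a facet functional the flag bound leaves at most one dimension of common null space,
  and strict growth from \<open>Q\<close> to its face gives at least one;
  \<open>face_rank_one\<close> then applies.\<close>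

lemma rooted_facet_exists:
  assumes span: "span H = UNIV" and card: "CARD('m) = DIM('v) + 1" and pos: "DIM('v) > 0"
    and l: "valid l" "l \<bullet> z < 0"
  obtains l' where "rooted l'" "l' \<bullet> z < 0" "\<And>h. h \<in> H \<Longrightarrow> l \<bullet> h = 0 \<Longrightarrow> l' \<bullet> h = 0"
proof -
  have dimH: "dim H = CARD('m)" using span card by (metis DIM_prod DIM_real add.commute dim_UNIV dim_span)
  obtain l' where l': "\<forall>h\<in>H. 0 \<le> l' \<bullet> h" "l' \<bullet> z < 0" "\<forall>h\<in>H. l \<bullet> h = 0 \<longrightarrow> l' \<bullet> h = 0"
    "dim H \<le> dim {h \<in> H. l' \<bullet> h = 0} + 1"
    using facet_exists[OF finite_H, of z l] l span unfolding valid_def by auto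
  have v': "valid l'" using l'(1) by (simp add: valid_def)
  have dt: "CARD('m) \<le> dim (tight l') + 1" using l'(4) dimH by (simp add: tight_def)
  then have ne: "tight l' \<noteq> {}" using pos card by auto
  then obtain x where x: "(1, x) \<in> tight l'" by (auto simp: tight_def H_def)
  then obtain Y where "Y \<in> Q" "\<pi> Y = x" using point_lift by (auto simp: tight_def)
  then have "Y \<in> face l'" using x by (auto simp: face_def eval_at_def tight_def)
  then have ne': "face l' \<noteq> {}" by auto
  have "dim (common_null (face l')) \<le> 1"
    using dim_common_null_tight[OF v' ne] dt by linarith
  moreover have "dim (common_null (face 0)) < dim (common_null (face (0 + l')))"
  proof -
    have "\<exists>h\<in>H. l' \<bullet> h \<noteq> 0"
    proof (rule ccontr)
      assume "\<not> ?thesis"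
      then have "span H \<subseteq> {h. l' \<bullet> h = 0}" by (intro span_minimal subspace_hyperplane) auto
      then have "z \<in> {h. l' \<bullet> h = 0}" using span by blast
      then show False using l'(2) by simp
    qed
    then obtain y where y: "(1, y) \<in> H" "l' \<bullet> (1, y) > 0"
      using l'(1) by (force simp: H_def less_le)
    then obtain Y where "Y \<in> Q" "\<pi> Y = y" using point_lift by blast
    then show ?thesis
      using y ne' by (intro dim_common_null_less[OF valid_zero v', of Y]) (auto simp: face_zero eval_at_def)
  qed
  ultimately have "dim (common_null (face l')) = 1" by simp
  from face_rank_one[OF v' ne' this] obtain c u where
    "0 \<le> c" "\<And>Y. Y \<in> Q \<Longrightarrow> eval_at l' Y = c * (u \<bullet> (Y *v u))" by blast
  then have "rooted l'" using v' by (auto simp: rooted_def)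
  then show thesis using that[of l'] l' by blast
qed

lemma eval_at_lift: "\<pi> Y = x \<Longrightarrow> eval_at l Y = l \<bullet> (1, x)"
  by (simp add: eval_at_def)

end

definition stable_vecs :: "'n::finite set set \<Rightarrow> (real^'n) set" where
  "stable_vecs E = {char_vec S | S. stable_set UNIV E S}"

lemma STAB_bounds: "x \<in> STAB E \<Longrightarrow> 0 \<le> x $ i \<and> x $ i \<le> 1"
proof -
  have "STAB E \<subseteq> {x. 0 \<le> axis i 1 \<bullet> x} \<inter> {x. axis i 1 \<bullet> x \<le> 1}"
    unfolding STAB_def
    by (intro hull_minimal convex_Int convex_halfspace_ge convex_halfspace_le)
      (auto simp: inner_axis' char_vec_def)
  then show "x \<in> STAB E \<Longrightarrow> 0 \<le> x $ i \<and> x $ i \<le> 1" by (auto simp: inner_axis')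
qed

lemma stable_set_empty: "stable_set UNIV E {}"
  by (simp add: stable_set_def)

lemma stable_set_pair:
  assumes "simple_graph UNIV E" "{i, j} \<notin> E" "S \<subseteq> {i, j}"
  shows "stable_set UNIV E S"
proof -
  have "{k} \<notin> E" for k using assms(1) by (auto simp: simple_graph_def)
  moreover have "{a, b} \<in> {{i}, {j}, {i, j}}" if "a \<in> S" "b \<in> S" for a b
    using that assms(3) by auto
  ultimately show ?thesis using assms(2) by (fastforce simp: stable_set_def)
qed

lemma stable_set_singleton: "simple_graph UNIV E \<Longrightarrow> stable_set UNIV E {i}"
  by (rule stable_set_pair[of E i i]) (auto simp: simple_graph_def)

text \<open>With the zero matrix in \<open>L\<close>, doubling a lift of a singleton would stay in
  \<open>L\<close> and in the cone, but its image leaves the unit cube.\<close>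

lemma psd_lifted_STAB:
  fixes E :: "'n::finite set set" and L :: "(real^'m^'m) set"
  assumes G: "simple_graph UNIV E" and L: "affine L" "linear \<pi>" and P: "STAB E = \<pi> ` {Y \<in> L. psd Y}"
  shows "psd_lifted_polytope L \<pi> (stable_vecs E)"
proof (rule psd_lifted_polytope.intro)
  show "finite (stable_vecs E)" by (simp add: stable_vecs_def)
  show "\<pi> ` {Y \<in> L. psd Y} = convex hull stable_vecs E"
    unfolding P[symmetric] by (simp add: STAB_def stable_vecs_def)
  show "0 \<notin> L"
  proof
    assume 0: "0 \<in> L"
    define i :: 'n where "i = undefined"
    have "char_vec {i} \<in> STAB E"
      unfolding STAB_def using stable_set_singleton[OF G, of i] by (intro hull_inc) auto
    then obtain Y where Y: "Y \<in> L" "psd Y" "\<pi> Y = char_vec {i}" unfolding P by auto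
    have "2 *\<^sub>R Y + (- 1) *\<^sub>R 0 \<in> L" by (rule mem_affine[OF L(1) Y(1) 0]) simp
    then have "\<pi> (2 *\<^sub>R Y) \<in> STAB E" unfolding P using psd_scale[OF Y(2), of 2] by auto
    then have "2 *\<^sub>R char_vec {i} \<in> STAB E" by (simp add: linear_scale[OF L(2)] Y(3))
    from STAB_bounds[OF this, of i] show False by (simp add: char_vec_def)
  qed
qed (use L in auto)

locale STAB_lift =
  psd_lifted_polytope L \<pi> "stable_vecs E"
  for L :: "(real^'m^'m) set" and \<pi> :: "real^'m^'m \<Rightarrow> real^'n" and E :: "'n::finite set set" +
  assumes graph: "simple_graph UNIV E"
begin

lemma stable_in_H: "stable_set UNIV E S \<Longrightarrow> (1, char_vec S) \<in> H"
  unfolding H_def by (auto simp: stable_vecs_def)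

lemma span_H: "span H = UNIV"
proof -
  have 0: "(1, 0) \<in> span H"
    using span_base[OF stable_in_H[OF stable_set_empty]]
    by (simp add: char_vec_def Finite_Cartesian_Product.zero_vec_def)
  have ax: "(0, axis i 1) \<in> span H" for i
  proof -
    have "char_vec {i} = (axis i 1 :: real^'n)" by (auto simp: char_vec_def axis_def)
    then have "(1, axis i 1) - (1, 0) \<in> span H"
      using span_base[OF stable_in_H[OF stable_set_singleton[OF graph, of i]]] 0
      by (intro span_diff) auto
    then show ?thesis by simp
  qed
  have "Basis \<subseteq> span H"
    using 0 ax by (auto simp: Basis_prod_def Basis_vec_def)
  then have "span Basis \<subseteq> span H" by (rule span_minimal) (rule subspace_span)
  then show ?thesis by auto
qed

lemma dim_H: "dim H = CARD('n) + 1"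
proof -
  have "dim (span H) = CARD('n) + 1" unfolding span_H by simp
  then show ?thesis by simp
qed

text \<open>Unit vectors outside \<open>I\<close> are annihilated by all of \<open>Q\<close>, so
  they use up that many dimensions in the bound for the full polytope.\<close>

lemma lift_size_ge:
  assumes "L \<subseteq> sym_supported I"
  shows "CARD('n) + 1 \<le> card I"
proof -
  define B :: "(real^'m) set" where "B = (\<lambda>p. axis p 1) ` (- I)"
  have "B \<subseteq> common_null Q"
  proof
    fix b assume "b \<in> B"
    then obtain p where p: "p \<notin> I" "b = axis p 1" by (auto simp: B_def)
    have "Y *v b = 0" if "Y \<in> Q" for Y
    proof -
      have "Y \<in> sym_supported I" using that assms Q_L by auto
      then have "column p Y = 0"
        using sym_supported_nth(2)[of Y I p] p(1) by (simp add: column_def Finite_Cartesian_Product.vec_eq_iff)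
      then show ?thesis by (simp add: p(2) matrix_vector_mul_component matrix_vector_mult_basis)
    qed
    then show "b \<in> common_null Q" by (auto simp: common_null_def null_space_def)
  qed
  moreover have "independent B"
    by (rule independent_mono[OF independent_Basis]) (auto simp: B_def Basis_vec_def)
  ultimately have "card B \<le> dim (common_null Q)" by (rule independent_card_le_dim)
  moreover have "card B = card (- I)"
    unfolding B_def by (rule card_image) (auto simp: inj_on_def axis_eq_axis)
  moreover have "tight 0 \<noteq> {}" using stable_in_H[OF stable_set_empty] by (auto simp: tight_zero)
  from dim_common_null_tight[OF valid_zero this] have "dim (common_null Q) + (CARD('n) + 1) \<le> CARD('m)"
    by (simp add: face_zero tight_zero dim_H)
  moreover have "card (- I) = CARD('m) - card I" by (simp add: card_compl)
  ultimately show ?thesis by linarith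
qed

text \<open>On the polytope this sum of nonnegative coordinates vanishes exactly where all
  coordinates in \<open>A\<close> do, so one functional describes the whole face.\<close>

definition coord :: "'n set \<Rightarrow> real \<times> (real^'n)" where
  "coord A = (0, char_vec A)"

definition cocoord :: "'n \<Rightarrow> real \<times> (real^'n)" where
  "cocoord k = (1, - char_vec {k})"

lemma coord_eval: "coord A \<bullet> (1, char_vec S) = real (card (A \<inter> S))"
  by (simp add: coord_def inner_char_vec_char_vec)

lemma cocoord_eval: "cocoord k \<bullet> (1, char_vec S) = (if k \<in> S then 0 else 1)"
  by (simp add: cocoord_def inner_char_vec_char_vec)

lemma valid_iff: "valid l \<longleftrightarrow> (\<forall>S. stable_set UNIV E S \<longrightarrow> 0 \<le> l \<bullet> (1, char_vec S))"
  unfolding valid_def H_def by (auto simp: stable_vecs_def)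

lemma valid_coord: "valid (coord A)" and valid_cocoord: "valid (cocoord k)"
  by (simp_all add: valid_iff coord_eval cocoord_eval)

lemma stable_lift:
  assumes "stable_set UNIV E S"
  obtains Y where "Y \<in> Q" "\<pi> Y = char_vec S"
  using point_lift[OF stable_in_H[OF assms]] by blast

text \<open>Strict growth in combinatorial form: \<open>S\<close> shows that the smaller face is
  nonempty, \<open>S'\<close> that it is smaller.\<close>

lemma dim_common_null_add:
  assumes l: "valid l" "valid k"
    and S: "stable_set UNIV E S" "(l + k) \<bullet> (1, char_vec S) = 0"
    and S': "stable_set UNIV E S'" "l \<bullet> (1, char_vec S') = 0" "k \<bullet> (1, char_vec S') > 0"
  shows "dim (common_null (face l)) + 1 \<le> dim (common_null (face (l + k)))"
proof -
  obtain Y where Y: "Y \<in> Q" "\<pi> Y = char_vec S" using stable_lift[OF S(1)] by blast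
  obtain Y' where Y': "Y' \<in> Q" "\<pi> Y' = char_vec S'" using stable_lift[OF S'(1)] by blast
  have "Y \<in> face (l + k)" using Y S(2) by (simp add: face_def eval_at_lift)
  moreover have "Y' \<in> face l" "eval_at k Y' > 0" using Y' S' by (simp_all add: face_def eval_at_lift)
  ultimately show ?thesis using dim_common_null_less[OF l] by fastforce
qed

text \<open>Coordinates are set to zero one at a time: \<open>{}\<close> stays in the face and
  \<open>{k}\<close> leaves it.\<close>

lemma dim_common_null_coord: "card A \<le> dim (common_null (face (coord A)))"
proof (induction A rule: finite_induct[OF finite])
  case (2 k A)
  have eq: "coord (insert k A) = coord A + coord {k}"
    using 2 by (auto simp: coord_def char_vec_def Finite_Cartesian_Product.vec_eq_iff)
  have "dim (common_null (face (coord A))) + 1 \<le> dim (common_null (face (coord A + coord {k})))"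
    using 2 by (intro dim_common_null_add[where S = "{}" and S' = "{k}"] valid_coord
        stable_set_empty stable_set_singleton graph) (auto simp: coord_eval inner_add_left)
  then show ?case using 2 by (simp add: eq)
qed simp

lemma rooted_STAB_facet_exists:
  assumes "CARD('m) = CARD('n) + 1" "valid l" "l \<bullet> z < 0"
  obtains l' where "rooted l'" "l' \<bullet> z < 0" "\<And>h. h \<in> H \<Longrightarrow> l \<bullet> h = 0 \<Longrightarrow> l' \<bullet> h = 0"
  using rooted_facet_exists[OF span_H _ _ assms(2,3)] assms(1) by (metis DIM_cart DIM_real mult.right_neutral zero_less_card_finite)

section \<open>The square face belonging to two nonadjacent vertices\<close>

context
  fixes i j :: 'n
  assumes ij: "i \<noteq> j" "{i, j} \<notin> E"
    and card_m: "CARD('m) = CARD('n) + 1"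
begin

definition corner :: "bool \<times> bool \<Rightarrow> 'n set" where
  "corner ab = (if fst ab then {i} else {}) \<union> (if snd ab then {j} else {})"

lemma stable_corner: "stable_set UNIV E (corner ab)"
  by (rule stable_set_pair[OF graph ij(2)]) (auto simp: corner_def)

text \<open>Descending from the square to an edge and to a corner adds two dimensions to the n - 2
  already present, so a matrix above a corner has rank at most one. All four vectors are orthogonal
  to the null space belonging to the square.\<close>

lemma corner_rank_one:
  "\<exists>Y (w :: bool \<times> bool \<Rightarrow> real^'m). \<forall>ab. Y ab \<in> Q \<and> \<pi> (Y ab) = char_vec (corner ab) \<and>
    (\<forall>v. v \<bullet> (Y ab *v v) = (w ab \<bullet> v)\<^sup>2) \<and> (\<forall>s\<in>common_null (face (coord (- {i, j}))). w ab \<bullet> s = 0)"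
proof -
  define l where "l = coord (- {i, j})"
  have cl: "CARD('n) - 2 \<le> dim (common_null (face l))"
    using dim_common_null_coord[of "- {i, j}"] ij(1) by (simp add: l_def card_compl)
  have n2: "CARD('n) \<ge> 2"
    using card_mono[of UNIV "{i, j}"] ij(1) by simp
  have ex: "\<exists>Y w. Y \<in> Q \<and> \<pi> Y = char_vec (corner ab) \<and> (\<forall>v. v \<bullet> (Y *v v) = (w \<bullet> v)\<^sup>2) \<and>
    (\<forall>s\<in>common_null (face l). w \<bullet> s = 0)" for ab
  proof -
    define f where "f = (if fst ab then cocoord i else coord {i})"
    define g where "g = (if snd ab then cocoord j else coord {j})"
    have v: "valid l" "valid f" "valid g"
      by (simp_all add: l_def f_def g_def valid_coord valid_cocoord)
    have lc: "l \<bullet> (1, char_vec (corner cd)) = 0" for cd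
      by (auto simp: l_def coord_eval corner_def)
    have fc: "f \<bullet> (1, char_vec (corner cd)) = (if fst cd = fst ab then 0 else 1)" for cd
      using ij(1) by (auto simp: f_def coord_eval cocoord_eval corner_def)
    have gc: "g \<bullet> (1, char_vec (corner cd)) = (if snd cd = snd ab then 0 else 1)" for cd
      using ij(1) by (auto simp: g_def coord_eval cocoord_eval corner_def)
    \<comment> \<open>The corner \<open>ab\<close> stays on the edge and one with the first entry
      flipped leaves it; the second entry \<open>True\<close> is an arbitrary choice.\<close>
    have "dim (common_null (face l)) + 1 \<le> dim (common_null (face (l + f)))"
      by (rule dim_common_null_add[OF v(1,2) stable_corner[of ab] _ stable_corner[of "(\<not> fst ab, True)"]])
        (simp_all add: inner_add_left lc fc)
    moreover have "dim (common_null (face (l + f))) + 1 \<le> dim (common_null (face (l + f + g)))"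
      by (rule dim_common_null_add[OF valid_add[OF v(1,2)] v(3) stable_corner[of ab] _
            stable_corner[of "(fst ab, \<not> snd ab)"]])
        (simp_all add: inner_add_left lc fc gc)
    ultimately have big: "CARD('n) \<le> dim (common_null (face (l + f + g)))"
      using cl n2 by linarith
    obtain Y where Y: "Y \<in> Q" "\<pi> Y = char_vec (corner ab)" using stable_lift[OF stable_corner] by blast
    have "Y \<in> face (l + f + g)"
      using Y by (simp add: face_def eval_at_lift inner_add_left lc fc gc)
    then have "common_null (face (l + f + g)) \<subseteq> null_space Y" by (auto simp: common_null_def)
    from dim_subset[OF this] have "CARD('m) \<le> dim (null_space Y) + 1" using big card_m by linarith
    then obtain w where w: "\<And>v. v \<bullet> (Y *v v) = (w \<bullet> v)\<^sup>2" "\<And>s. s \<in> null_space Y \<Longrightarrow> w \<bullet> s = 0"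
      using psd_rank_le_one[OF Q_psd[OF Y(1)]] by blast
    have "Y \<in> face l" using Y by (simp add: face_def eval_at_lift lc)
    then have "common_null (face l) \<subseteq> null_space Y" by (auto simp: common_null_def)
    then show ?thesis using Y w by blast
  qed
  then show ?thesis unfolding l_def by metis
qed

text \<open>Four vectors in a space of dimension at most three are dependent. The coefficients are
  chosen before \<open>l\<close>, so the same relation serves all rooted functionals.\<close>

lemma corner_relation:
  "\<exists>c :: real^(bool \<times> bool). c \<noteq> 0 \<and> (\<forall>l. rooted l \<longrightarrow>
    (\<exists>r. (\<forall>ab. (r ab)\<^sup>2 = l \<bullet> (1, char_vec (corner ab))) \<and> (\<Sum>ab\<in>UNIV. c $ ab * r ab) = 0))"
proof -
  obtain Y and w :: "bool \<times> bool \<Rightarrow> real^'m" where "\<forall>ab. Y ab \<in> Q \<and> \<pi> (Y ab) = char_vec (corner ab) \<and>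
    (\<forall>v. v \<bullet> (Y ab *v v) = (w ab \<bullet> v)\<^sup>2) \<and> (\<forall>s\<in>common_null (face (coord (- {i, j}))). w ab \<bullet> s = 0)"
    using corner_rank_one by metis
  then have Y: "Y ab \<in> Q" "\<pi> (Y ab) = char_vec (corner ab)" "v \<bullet> (Y ab *v v) = (w ab \<bullet> v)\<^sup>2"
    "s \<in> common_null (face (coord (- {i, j}))) \<Longrightarrow> w ab \<bullet> s = 0" for ab v s
    by blast+
  have "CARD('n) - 2 \<le> dim (common_null (face (coord (- {i, j}))))"
    using dim_common_null_coord[of "- {i, j}"] ij(1) by (simp add: card_compl)
  moreover have "CARD('n) \<ge> 2"
    using card_mono[of UNIV "{i, j}"] ij(1) by simp
  ultimately have dim: "DIM(real^'m) < dim (common_null (face (coord (- {i, j})))) + CARD(bool \<times> bool)"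
    using card_m by (simp add: card_cartesian_product flip: UNIV_Times_UNIV)
  obtain c where c: "c \<noteq> 0" "(\<Sum>ab\<in>UNIV. c $ ab *\<^sub>R w ab) = 0"
    by (rule linear_dependence[OF subspace_common_null dim Y(4)])
  show ?thesis
  proof (intro exI[of _ c] conjI allI impI c(1))
    fix l assume "rooted l"
    then obtain k u where k: "0 \<le> k" "\<And>Y. Y \<in> Q \<Longrightarrow> eval_at l Y = k * (u \<bullet> (Y *v u))"
      by (auto simp: rooted_def)
    define r where "r ab = sqrt k * (w ab \<bullet> u)" for ab
    have "(r ab)\<^sup>2 = l \<bullet> (1, char_vec (corner ab))" for ab
      using k(2)[OF Y(1), of ab] k(1) by (simp add: r_def power_mult_distrib Y(3) eval_at_lift[OF Y(2)])
    moreover have "(\<Sum>ab\<in>UNIV. c $ ab * r ab) = 0"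
    proof -
      have "(\<Sum>ab\<in>UNIV. c $ ab * r ab) = sqrt k * ((\<Sum>ab\<in>UNIV. c $ ab *\<^sub>R w ab) \<bullet> u)"
        by (simp add: inner_sum_left sum_distrib_left r_def mult_ac)
      then show ?thesis using c(2) by simp
    qed
    ultimately show "\<exists>r. (\<forall>ab. (r ab)\<^sup>2 = l \<bullet> (1, char_vec (corner ab))) \<and> (\<Sum>ab\<in>UNIV. c $ ab * r ab) = 0"
      by blast
  qed
qed

lemma corner_sum:
  fixes l :: "real \<times> (real^'n)"
  shows "l \<bullet> (1, char_vec (corner (True, True))) + l \<bullet> (1, char_vec (corner (False, False))) =
   l \<bullet> (1, char_vec (corner (True, False))) + l \<bullet> (1, char_vec (corner (False, True)))"
proof -
  have "(1::real, char_vec (corner (True, True))) + (1, char_vec (corner (False, False))) =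
    (1, char_vec (corner (True, False))) + (1, char_vec (corner (False, True)))"
    using ij(1) by (auto simp: corner_def char_vec_def Finite_Cartesian_Product.vec_eq_iff)
  from arg_cong[OF this, of "inner l"] show ?thesis by (simp only: inner_add_right)
qed

text \<open>The functionals \<open>x\<^sub>i\<close>, \<open>x\<^sub>j\<close> and \<open>1 - x\<^sub>i\<close> force the four coefficients of the linear
  relation to have equal absolute values; squaring the relation between the roots of \<open>l\<close> then gives
  the claim.\<close>

lemma rooted_corner_product:
  assumes l: "rooted l"
  shows "(l \<bullet> (1, char_vec (corner (True, True)))) * (l \<bullet> (1, char_vec (corner (False, False)))) =
   (l \<bullet> (1, char_vec (corner (True, False)))) * (l \<bullet> (1, char_vec (corner (False, True))))"
proof -
  obtain c :: "real^(bool \<times> bool)" where c: "c \<noteq> 0"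
    "\<And>l. rooted l \<Longrightarrow> \<exists>r. (\<forall>ab. (r ab)\<^sup>2 = l \<bullet> (1, char_vec (corner ab))) \<and> (\<Sum>ab\<in>UNIV. c $ ab * r ab) = 0"
    using corner_relation by metis
  have expand: "(\<Sum>ab\<in>UNIV. f ab) = f (True, True) + f (True, False) + f (False, True) + f (False, False)"
    for f :: "bool \<times> bool \<Rightarrow> real"
    by (simp add: UNIV_bool flip: UNIV_Times_UNIV)
  have eq: "(c $ p)\<^sup>2 = (c $ q)\<^sup>2"
    if k: "valid k" "k \<bullet> (1, char_vec (corner p)) > 0"
      "k \<bullet> (1, char_vec (corner p')) = 0" "k \<bullet> (1, char_vec (corner q')) = 0"
      and pq: "(p, q, p', q') \<in> {((True, False), (True, True), (False, False), (False, True)),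
        ((False, True), (True, True), (False, False), (True, False)),
        ((False, False), (False, True), (True, False), (True, True))}"
    for k p q p' q'
  proof -
    \<comment> \<open>\<open>1 - x\<^sub>i\<close> is in general not a facet functional. It is
      replaced by a rooted one with at least the same zeros; cutting off the negative of the corner
      \<open>p\<close> keeps it positive at \<open>p\<close>.\<close>
    have "k \<bullet> (- (1, char_vec (corner p))) < 0" using k(2) unfolding inner_minus_right by simp
    then obtain l' where l': "rooted l'"
      "l' \<bullet> (- (1, char_vec (corner p))) < 0" "\<And>h. h \<in> H \<Longrightarrow> k \<bullet> h = 0 \<Longrightarrow> l' \<bullet> h = 0"
      using rooted_STAB_facet_exists[OF card_m k(1)] by metis
    have z: "l' \<bullet> (1, char_vec (corner p')) = 0" "l' \<bullet> (1, char_vec (corner q')) = 0"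
      using l'(3)[OF stable_in_H[OF stable_corner]] k by blast+
    have pos: "l' \<bullet> (1, char_vec (corner p)) > 0" using l'(2) unfolding inner_minus_right by simp
    have same: "l' \<bullet> (1, char_vec (corner q)) = l' \<bullet> (1, char_vec (corner p))"
      using corner_sum[of l'] z pq by auto
    obtain r where r: "\<And>ab. (r ab)\<^sup>2 = l' \<bullet> (1, char_vec (corner ab))" "(\<Sum>ab\<in>UNIV. c $ ab * r ab) = 0"
      using c(2)[OF l'(1)] by blast
    have "r p' = 0" "r q' = 0" using r(1)[of p'] r(1)[of q'] z by auto
    then have "c $ p * r p = - (c $ q * r q)" using r(2) pq unfolding expand by auto
    then have "(c $ p)\<^sup>2 * (r p)\<^sup>2 = (c $ q)\<^sup>2 * (r q)\<^sup>2"
      by (metis power2_minus power_mult_distrib)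
    then show ?thesis using r(1) same pos by simp
  qed
  \<comment> \<open>The three edges used form a path through all four corners of the square.\<close>
  have c1: "(c $ (True, False))\<^sup>2 = (c $ (True, True))\<^sup>2"
    by (rule eq[of "coord {i}" _ "(False, False)" "(False, True)"])
      (use ij(1) in \<open>auto simp: valid_coord coord_eval corner_def\<close>)
  have c2: "(c $ (False, True))\<^sup>2 = (c $ (True, True))\<^sup>2"
    by (rule eq[of "coord {j}" _ "(False, False)" "(True, False)"])
      (use ij(1) in \<open>auto simp: valid_coord coord_eval corner_def\<close>)
  have c3: "(c $ (False, False))\<^sup>2 = (c $ (False, True))\<^sup>2"
    by (rule eq[of "cocoord i" _ "(True, False)" "(True, True)"])
      (use ij(1) in \<open>auto simp: valid_cocoord cocoord_eval corner_def\<close>)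
  define C where "C = (c $ (True, True))\<^sup>2"
  have C: "(c $ ab)\<^sup>2 = C" for ab
    using c1 c2 c3 by (cases ab; cases "fst ab"; cases "snd ab") (auto simp: C_def)
  have "C \<noteq> 0"
  proof
    assume "C = 0"
    then have "c = 0" using C by (simp add: Finite_Cartesian_Product.vec_eq_iff)
    then show False using c(1) by simp
  qed
  obtain r where r: "\<And>ab. (r ab)\<^sup>2 = l \<bullet> (1, char_vec (corner ab))" "(\<Sum>ab\<in>UNIV. c $ ab * r ab) = 0"
    using c(2)[OF l] by blast
  define A B D F where "A = c $ (True, True) * r (True, True)" and "B = c $ (True, False) * r (True, False)"
    and "D = c $ (False, True) * r (False, True)" and "F = c $ (False, False) * r (False, False)"
  have sq: "A\<^sup>2 = C * (r (True, True))\<^sup>2" "B\<^sup>2 = C * (r (True, False))\<^sup>2"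
    "D\<^sup>2 = C * (r (False, True))\<^sup>2" "F\<^sup>2 = C * (r (False, False))\<^sup>2"
    by (simp_all add: A_def B_def D_def F_def power_mult_distrib C)
  have "A + F = - (B + D)" using r(2) unfolding expand A_def B_def D_def F_def by simp
  then have "(A + F)\<^sup>2 = (B + D)\<^sup>2" by (metis power2_minus)
  \<comment> \<open>All coefficients have square \<open>C\<close>, so \<open>corner_sum\<close>
    makes the sums of squares agree and only the mixed products remain.\<close>
  moreover have "A\<^sup>2 + F\<^sup>2 = B\<^sup>2 + D\<^sup>2"
    using corner_sum[of l] unfolding sq r(1) by (metis distrib_left)
  ultimately have "A * F = B * D" by (simp add: power2_sum)
  then have "A\<^sup>2 * F\<^sup>2 = B\<^sup>2 * D\<^sup>2" by (metis power_mult_distrib)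
  then have "C * C * ((r (True, True))\<^sup>2 * (r (False, False))\<^sup>2) =
    C * C * ((r (True, False))\<^sup>2 * (r (False, True))\<^sup>2)"
    unfolding sq by (simp add: mult_ac)
  then show ?thesis using \<open>C \<noteq> 0\<close> by (simp add: r(1))
qed

text \<open>With constant term b and coefficients p, q at \<open>i\<close>, \<open>j\<close>, the
  product identity reads (b + p + q) b = (b + p)(b + q), that is, p q = 0.\<close>

lemma rooted_nonadjacent:
  assumes "rooted l"
  shows "snd l $ i = 0 \<or> snd l $ j = 0"
proof -
  have v: "l \<bullet> (1, char_vec (corner ab)) =
      fst l + ((if fst ab then snd l $ i else 0) + (if snd ab then snd l $ j else 0))" for ab
  proof -
    have "l \<bullet> (1, char_vec (corner ab)) = fst l + (\<Sum>k\<in>corner ab. snd l $ k)"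
      using inner_char_vec[of "corner ab" "snd l"] by (cases l) (simp add: inner_commute)
    then show ?thesis using ij(1) by (simp add: corner_def)
  qed
  from rooted_corner_product[OF assms] have "snd l $ i * snd l $ j = 0"
    unfolding v by (simp add: algebra_simps)
  then show ?thesis by simp
qed

end

lemma QSTAB_subset_STAB:
  assumes card_m: "CARD('m) = CARD('n) + 1"
  shows "QSTAB E \<subseteq> STAB E"
proof (rule ccontr)
  assume "\<not> ?thesis"
  then obtain z where z: "z \<in> QSTAB E" "z \<notin> STAB E" by blast
  have "convex (STAB E)" by (simp add: STAB_def)
  then obtain a b where ab: "a \<bullet> z < b" "\<And>x. x \<in> STAB E \<Longrightarrow> b < a \<bullet> x"
    using separating_hyperplane_closed_point[OF _ closed_STAB z(2)] by blast
  have inS: "char_vec S \<in> STAB E" if "stable_set UNIV E S" for S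
    using that unfolding STAB_def by (intro hull_inc) auto
  have "valid (- b, a)" using ab(2)[OF inS] by (force simp: valid_iff)
  moreover have "(- b, a) \<bullet> (1, z) < 0" using ab(1) by simp
  ultimately obtain l where l: "rooted l" "l \<bullet> (1, z) < 0"
    using rooted_STAB_facet_exists[OF card_m] by metis
  define d where "d k = - (snd l $ k)" for k
  have ev: "l \<bullet> (1, x) = fst l - (\<Sum>k\<in>UNIV. d k * x $ k)" for x
    by (cases l) (simp add: inner_vec_def d_def sum_negf)
  have val: "0 \<le> l \<bullet> (1, char_vec S)" if "stable_set UNIV E S" for S
    using l(1) that by (simp add: rooted_def valid_iff)
  have b0: "0 \<le> fst l" using val[OF stable_set_empty] by (simp add: ev char_vec_def)
  have bd: "d k \<le> fst l" for k
  proof -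
    have "(\<Sum>m\<in>UNIV. d m * char_vec {k} $ m) = (\<Sum>m\<in>UNIV. if m = k then d m else 0)"
      by (rule sum.cong) (auto simp: char_vec_def)
    then show ?thesis using val[OF stable_set_singleton[OF graph, of k]] by (simp add: ev)
  qed
  define P where "P = {k. d k > 0}"
  have "clique UNIV E P"
    unfolding clique_def
  proof (intro conjI ballI impI)
    fix i j assume "i \<in> P" "j \<in> P" "i \<noteq> j"
    then show "{i, j} \<in> E"
      using rooted_nonadjacent[of i j, OF _ _ card_m l(1)] by (auto simp: P_def d_def)
  qed simp
  then have zP: "(\<Sum>k\<in>P. z $ k) \<le> 1" using z(1) by (simp add: QSTAB_def)
  have z0: "0 \<le> z $ k" for k using z(1) by (simp add: QSTAB_def)
  \<comment> \<open>Nonpositive coefficients may be dropped because \<open>z\<close> is nonnegative;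
    the others are at most \<open>fst l\<close> by validity at singletons, so the clique inequality
    for \<open>P\<close> suffices.\<close>
  have "(\<Sum>k\<in>UNIV. d k * z $ k) \<le> (\<Sum>k\<in>UNIV. if k \<in> P then fst l * z $ k else 0)"
    using bd z0 by (intro sum_mono) (auto simp: P_def intro: mult_right_mono mult_nonpos_nonneg)
  also have "\<dots> = fst l * (\<Sum>k\<in>P. z $ k)" by (simp add: sum.If_cases sum_distrib_left)
  also have "\<dots> \<le> fst l" using mult_left_mono[OF zP b0] by simp
  finally show False using l(2) by (simp add: ev)
qed

end

section \<open>Constructions of lifts\<close>

lemma has_psd_lift_card:
  fixes L :: "(real^'m^'m) set"
  assumes "affine L" "\<And>Y. Y \<in> L \<Longrightarrow> transpose Y = Y" "linear \<pi>"
  shows "has_psd_lift CARD('m) (\<pi> ` {Y \<in> L. psd Y})"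
proof -
  obtain g :: "nat \<Rightarrow> 'm" where g: "bij_betw g {0..<CARD('m)} UNIV"
    using ex_bij_betw_nat_finite[of "UNIV :: 'm set"] by auto
  then have inj: "inj_on g {..<CARD('m)}" and im: "g ` {..<CARD('m)} = UNIV"
    by (auto simp: bij_betw_def lessThan_atLeast0)
  show ?thesis
    unfolding has_psd_lift_iff[OF inj] im using assms
    by (intro exI[of _ L] exI[of _ \<pi>]) (auto simp: sym_supported_def)
qed

lemma convex_psd: "convex {Y. psd Y}"
  by (auto simp: convex_def intro!: psd_add psd_scale)

lemma psd_diagonal: "psd Y \<Longrightarrow> 0 \<le> Y $ p $ p"
  unfolding psd_def by (drule conjunct2, drule spec[of _ "axis p 1"])
    (simp add: inner_axis' matrix_vector_mult_basis column_def)

definition outer :: "real^'m \<Rightarrow> real^'m^'m" where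
  "outer s = (\<chi> p q. s $ p * s $ q)"

lemma psd_outer: "psd (outer s)"
proof -
  have "outer s *v v = (s \<bullet> v) *\<^sub>R s" for v
    by (simp add: outer_def matrix_vector_mult_def inner_vec_def Finite_Cartesian_Product.vec_eq_iff
        sum_distrib_left sum_distrib_right mult_ac)
  then show ?thesis
    by (simp add: psd_def inner_commute[of s])
      (simp add: outer_def transpose_def Finite_Cartesian_Product.vec_eq_iff mult.commute)
qed

lemma STAB_subset_image:
  assumes "affine L" "linear \<pi>" "\<And>S. stable_set UNIV E S \<Longrightarrow> char_vec S \<in> \<pi> ` {Y \<in> L. psd Y}"
  shows "STAB E \<subseteq> \<pi> ` {Y \<in> L. psd Y}"
  unfolding STAB_def
proof (rule hull_minimal)
  have "convex (L \<inter> {Y. psd Y})" by (intro convex_Int affine_imp_convex assms convex_psd)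
  then show "convex (\<pi> ` {Y \<in> L. psd Y})"
    using convex_linear_image[OF assms(2)] by (simp add: Int_def)
qed (use assms(3) in auto)

text \<open>Guarantees that the minimum defining the psd rank is attained. Diagonal matrices of
  trace one encode convex combinations; they are indexed by all vertex sets, with zeros forced at
  the sets that are not stable.\<close>

lemma STAB_has_psd_lift: "\<exists>k>0. has_psd_lift k (STAB (E :: 'n::finite set set))"
proof -
  define L :: "(real^'n set^'n set) set" where "L = {Y. (\<forall>S T. S \<noteq> T \<longrightarrow> Y $ S $ T = 0) \<and>
    (\<forall>S. \<not> stable_set UNIV E S \<longrightarrow> Y $ S $ S = 0) \<and> (\<Sum>S\<in>UNIV. Y $ S $ S) = 1}"
  define \<pi> :: "real^'n set^'n set \<Rightarrow> real^'n" where "\<pi> Y = (\<Sum>S\<in>UNIV. Y $ S $ S *\<^sub>R char_vec S)" for Y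
  have aff: "affine L"
    by (auto simp: L_def affine_def sum.distrib sum_distrib_left[symmetric])
  have lin: "linear \<pi>"
    unfolding \<pi>_def by (intro linearI) (simp_all add: scaleR_add_left sum.distrib scaleR_sum_right)
  have sym: "transpose Y = Y" if "Y \<in> L" for Y
  proof -
    have "Y $ T $ S = Y $ S $ T" for S T using that by (cases "S = T") (auto simp: L_def)
    then show ?thesis by (simp add: transpose_def Finite_Cartesian_Product.vec_eq_iff)
  qed
  have "STAB E = \<pi> ` {Y \<in> L. psd Y}"
  proof
    show "STAB E \<subseteq> \<pi> ` {Y \<in> L. psd Y}"
    proof (rule STAB_subset_image[OF aff lin])
      fix S assume S: "stable_set UNIV E S"
      have d: "outer (axis S 1) $ T $ U = (if T = S \<and> U = S then 1 else 0)" for T U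
        by (simp add: outer_def axis_def)
      have "outer (axis S 1) \<in> {Y \<in> L. psd Y}"
        using S by (auto simp: L_def d psd_outer)
      moreover have "\<pi> (outer (axis S 1)) = char_vec S"
        by (simp add: \<pi>_def d if_distrib[of "\<lambda>x. x *\<^sub>R _"] cong: if_cong)
      ultimately show "char_vec S \<in> \<pi> ` {Y \<in> L. psd Y}" by (metis imageI)
    qed
    show "\<pi> ` {Y \<in> L. psd Y} \<subseteq> STAB E"
    proof safe
      fix Y assume Y: "Y \<in> L" "psd Y"
      have "\<pi> Y = (\<Sum>S\<in>{S. stable_set UNIV E S}. Y $ S $ S *\<^sub>R char_vec S)"
        unfolding \<pi>_def using Y(1) by (intro sum.mono_neutral_right) (auto simp: L_def)
      also have "\<dots> \<in> STAB E"
      proof (rule convex_sum)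
        have "(\<Sum>S\<in>{S. stable_set UNIV E S}. Y $ S $ S) = (\<Sum>S\<in>UNIV. Y $ S $ S)"
          using Y(1) by (intro sum.mono_neutral_left) (auto simp: L_def)
        then show "(\<Sum>S\<in>{S. stable_set UNIV E S}. Y $ S $ S) = 1" using Y(1) by (simp add: L_def)
        show "char_vec S \<in> STAB E" if "S \<in> {S. stable_set UNIV E S}" for S
          using that unfolding STAB_def by (intro hull_inc) auto
      qed (auto simp: STAB_def psd_diagonal[OF Y(2)])
      finally show "\<pi> Y \<in> STAB E" .
    qed
  qed
  then have "has_psd_lift CARD('n set) (STAB E)" using has_psd_lift_card[OF aff sym lin] by simp
  then show ?thesis by (intro exI[of _ "CARD('n set)"]) simp
qed

lemma sum_option: "(\<Sum>p\<in>UNIV. f p) = f None + (\<Sum>i\<in>UNIV. f (Some i))"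
  for f :: "'n::finite option \<Rightarrow> real"
  by (simp add: UNIV_option_conv sum.reindex)

text \<open>The lift is the theta body of Lovasz, which lies between \<open>STAB\<close> and \<open>QSTAB\<close>.\<close>

lemma theta_body_lift:
  fixes E :: "'n::finite set set"
  assumes G: "simple_graph UNIV E" and sub: "QSTAB E \<subseteq> STAB E"
  shows "has_psd_lift (CARD('n) + 1) (STAB E)"
proof -
  define L :: "(real^'n option^'n option) set" where
    "L = {Y. transpose Y = Y \<and> Y $ None $ None = 1 \<and> (\<forall>i. Y $ None $ Some i = Y $ Some i $ Some i) \<and>
      (\<forall>i j. {i, j} \<in> E \<longrightarrow> Y $ Some i $ Some j = 0)}"
  define \<pi> :: "real^'n option^'n option \<Rightarrow> real^'n" where "\<pi> Y = (\<chi> i. Y $ None $ Some i)" for Y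
  have aff: "affine L"
    by (auto simp: L_def affine_def transpose_add transpose_scale)
  have lin: "linear \<pi>"
    unfolding \<pi>_def by (intro linearI) (simp_all add: Finite_Cartesian_Product.vec_eq_iff)
  have "STAB E = \<pi> ` {Y \<in> L. psd Y}"
  proof
    show "STAB E \<subseteq> \<pi> ` {Y \<in> L. psd Y}"
    proof (rule STAB_subset_image[OF aff lin])
      fix S assume S: "stable_set UNIV E S"
      define s :: "real^'n option" where "s = (\<chi> p. case p of None \<Rightarrow> 1 | Some i \<Rightarrow> if i \<in> S then 1 else 0)"
      have "outer s \<in> {Y \<in> L. psd Y}"
        using psd_outer[of s] S
        by (auto simp: L_def psd_def) (auto simp: outer_def s_def stable_set_def)
      moreover have "\<pi> (outer s) = char_vec S"
        by (simp add: \<pi>_def outer_def s_def char_vec_def)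
      ultimately show "char_vec S \<in> \<pi> ` {Y \<in> L. psd Y}" by (metis imageI)
    qed
    have "\<pi> Y \<in> QSTAB E" if Y: "Y \<in> L" "psd Y" for Y
      unfolding QSTAB_def
    proof (intro CollectI conjI allI impI)
      have diag: "Y $ None $ Some i = Y $ Some i $ Some i" for i using Y(1) by (simp add: L_def)
      show "0 \<le> \<pi> Y $ i" for i
        using psd_diagonal[OF Y(2), of "Some i"] by (simp add: \<pi>_def diag)
      fix C assume C: "clique UNIV E C"
      \<comment> \<open>For this vector \<open>Y *v v\<close> vanishes on the clique, because
        off-diagonal entries there are 0 and the diagonal equals the border. The form at
        \<open>v\<close> thus reduces to the slack of the clique inequality.\<close>
      define v :: "real^'n option" where "v = (\<chi> p. case p of None \<Rightarrow> 1 | Some i \<Rightarrow> if i \<in> C then - 1 else 0)"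
      have Yv: "(Y *v v) $ p = Y $ p $ None - (\<Sum>j\<in>C. Y $ p $ Some j)" for p
      proof -
        have "(\<Sum>j\<in>UNIV. Y $ p $ Some j * (if j \<in> C then - 1 else 0)) = (\<Sum>j\<in>UNIV. if j \<in> C then - Y $ p $ Some j else 0)"
          by (rule sum.cong) auto
        then show ?thesis
          by (simp add: matrix_vector_mult_def sum_option v_def sum.If_cases sum_negf)
      qed
      have Yv0: "(Y *v v) $ Some i = 0" if "i \<in> C" for i
      proof -
        have "(\<Sum>j\<in>C. Y $ Some i $ Some j) = (\<Sum>j\<in>C. if j = i then Y $ Some i $ Some i else 0)"
          using C that Y(1) by (intro sum.cong) (auto simp: clique_def L_def)
        also have "\<dots> = Y $ Some i $ Some i" using that by simp
        also have "\<dots> = Y $ Some i $ None"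
          using diag sym_supported_nth(1)[of Y UNIV] Y(1) by (simp add: sym_supported_def L_def)
        finally show ?thesis by (simp add: Yv)
      qed
      have "0 \<le> v \<bullet> (Y *v v)" using Y(2) by (simp add: psd_def)
      also have "\<dots> = (Y *v v) $ None + (\<Sum>i\<in>UNIV. v $ Some i * (Y *v v) $ Some i)"
        by (simp add: inner_vec_def sum_option) (simp add: v_def)
      also have "(\<Sum>i\<in>UNIV. v $ Some i * (Y *v v) $ Some i) = 0"
        using Yv0 by (intro sum.neutral) (auto simp: v_def)
      finally show "(\<Sum>i\<in>C. \<pi> Y $ i) \<le> 1" using Y(1) by (simp add: Yv \<pi>_def L_def)
    qed
    then show "\<pi> ` {Y \<in> L. psd Y} \<subseteq> STAB E" using sub by auto
  qed
  then show ?thesis using has_psd_lift_card[OF aff _ lin] by (simp add: L_def)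
qed

text \<open>The index type \<open>'n option\<close> has n + 1 elements: it has room for every
  \<open>k\<close> considered, and its size is the one required by
  \<open>QSTAB_subset_STAB\<close>.\<close>

lemma psd_lift_STAB:
  fixes E :: "'n::finite set set"
  assumes G: "simple_graph UNIV E" and lift: "has_psd_lift k (STAB E)" and k: "k \<le> CARD('n) + 1"
  shows "k = CARD('n) + 1 \<and> QSTAB E \<subseteq> STAB E"
proof -
  obtain g :: "nat \<Rightarrow> 'n option" where "bij_betw g {0..<CARD('n option)} UNIV"
    using ex_bij_betw_nat_finite[of "UNIV :: 'n option set"] by auto
  then have inj: "inj_on g {..<k}"
    using k by (auto simp: bij_betw_def intro: inj_on_subset)
  obtain L :: "(real^'n option^'n option) set" and \<pi> :: "real^'n option^'n option \<Rightarrow> real^'n"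
    where L: "affine L" "L \<subseteq> sym_supported (g ` {..<k})" "linear \<pi>" "STAB E = \<pi> ` {Y \<in> L. psd Y}"
    using lift unfolding has_psd_lift_iff[OF inj] by blast
  interpret STAB_lift L \<pi> E
    by (intro STAB_lift.intro STAB_lift_axioms.intro psd_lifted_STAB G L)
  have "CARD('n) + 1 \<le> card (g ` {..<k})" by (rule lift_size_ge[OF L(2)])
  also have "\<dots> = k" using card_image[OF inj] by simp
  finally show ?thesis using k QSTAB_subset_STAB by simp
qed

theorem theorem4p12:
  fixes E :: "'n::finite set set"
  assumes "simple_graph (UNIV :: 'n set) E"
  shows "psd_rank (STAB E) = CARD('n) + 1 \<longleftrightarrow> perfect_graph UNIV E"
proof
  assume "psd_rank (STAB E) = CARD('n) + 1"
  moreover have "has_psd_lift (psd_rank (STAB E)) (STAB E)"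
    unfolding psd_rank_def by (rule LeastI2_ex[OF STAB_has_psd_lift]) simp
  ultimately have "QSTAB E \<subseteq> STAB E" using psd_lift_STAB[OF assms, of "CARD('n) + 1"] by simp
  then show "perfect_graph UNIV E" by (rule QSTAB_subset_STAB_imp_perfect[OF assms])
next
  assume "perfect_graph UNIV E"
  then have "has_psd_lift (CARD('n) + 1) (STAB E)"
    by (intro theta_body_lift perfect_imp_QSTAB_subset_STAB assms)
  moreover have "CARD('n) + 1 \<le> k" if "has_psd_lift k (STAB E)" for k
    using psd_lift_STAB[OF assms that] by linarith
  ultimately show "psd_rank (STAB E) = CARD('n) + 1"
    unfolding psd_rank_def by (intro Least_equality) auto
qed

end
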